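(* There is a fixed polynomial $p$ such that for every constant $\varepsilon>0$, every Abelian group $G$, every $n\ge1$ and every function $f:\{0,1\}^n\to G$, the number of polynomials $P\in\mathcal{P}_1(\{0,1\}^n,G)$ with $\delta(f,P)\le \frac12-\varepsilon$ is at most $p(1/\varepsilon)$; i.e. $\mathcal{P}_1$ is $(\frac12-\varepsilon,\mathrm{poly}(1/\varepsilon))$-list decodable.
   Context: $\mathcal{P}_1(\{0,1\}^n,G)$ is the set of functions $P(x)=a_0+\sum_{i=1}^n a_ix_i$ with $a_i\in G$, where $x\in\{0,1\}^n$ and $\{0,1\}\subseteq\mathbb{Z}$. $\delta(f,P)=\Pr_{x\sim\{0,1\}^n}[f(x)\ne P(x)]$. A class $\mathcal{F}$ is $(\delta,L)$-list decodable if for every $f$ at most $L$ elements of $\mathcal{F}$ are $\delta$-close to $f$. *)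

theory Defs
  imports
    "HOL-Algebra.Group"
    "HOL-Algebra.FiniteProduct"
    "HOL-Computational_Algebra.Polynomial"
    "HOL-Probability.Probability"
begin

definition cube :: "nat \<Rightarrow> (nat \<Rightarrow> int) set" where
  "cube n = {1..n} \<rightarrow>\<^sub>E {0, 1}"

text \<open>The group operation is written multiplicatively, so \<open>a\<^sub>0 + \<Sum>\<^sub>i a\<^sub>i x\<^sub>i\<close> appears as
  \<open>a\<^sub>0 \<otimes> \<Prod>\<^sub>i a\<^sub>i [^] x\<^sub>i\<close>. The members are functions on the cube, normalised to
  \<open>undefined\<close> outside of it so that equality is equality on the cube.\<close>

definition linear_polys :: "nat \<Rightarrow> ('a, 'b) monoid_scheme \<Rightarrow> ((nat \<Rightarrow> int) \<Rightarrow> 'a) set" where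
  "linear_polys n G =
     {restrict (\<lambda>x. a 0 \<otimes>\<^bsub>G\<^esub> finprod G (\<lambda>i. a i [^]\<^bsub>G\<^esub> x i) {1..n}) (cube n) | a.
        a \<in> {0..n} \<rightarrow> carrier G}"

definition rel_dist :: "'x set \<Rightarrow> ('x \<Rightarrow> 'a) \<Rightarrow> ('x \<Rightarrow> 'a) \<Rightarrow> real" where
  "rel_dist X f g = measure_pmf.prob (pmf_of_set X) {x. f x \<noteq> g x}"

definition list_decodable ::
    "'x set \<Rightarrow> 'a set \<Rightarrow> ('x \<Rightarrow> 'a) set \<Rightarrow> real \<Rightarrow> real \<Rightarrow> bool" where
  "list_decodable X Y F \<delta> L \<longleftrightarrow>
     (\<forall>f \<in> X \<rightarrow> Y. finite {P \<in> F. rel_dist X f P \<le> \<delta>} \<and>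
        real (card {P \<in> F. rel_dist X f P \<le> \<delta>}) \<le> L)"

text \<open>One polynomial has to serve groups on all carrier types at once, but a type cannot be
  quantified underneath an existential quantifier: in \<open>\<exists>p. \<forall>G :: 'a monoid. \<dots>\<close> the witness
  could depend on \<open>'a\<close>. Hence the polynomial is a closed constant, chosen by means of the
  groups with carrier in \<open>nat\<close>. This loses nothing: any finitely many linear polynomials
  together with a function on the cube involve only a finitely generated, hence countable,
  subgroup, so every polynomial bound valid for all groups on \<open>nat\<close> is valid for all
  Abelian groups.\<close>

definition list_size_poly :: "real poly" where
  "list_size_poly =
     (SOME p. \<forall>\<epsilon>>0. \<forall>G :: nat monoid. comm_group G \<longrightarrow> (\<forall>n\<ge>1.
        list_decodable (cube n) (carrier G) (linear_polys n G) (1/2 - \<epsilon>) (poly p (1/\<epsilon>))))"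

end

theory Submission
  imports Defs "HOL-Algebra.Generated_Groups"
begin

text \<open>
  A Johnson-type double count shows that a list of \<open>N\<close> functions, each agreeing with \<open>f\<close> on a
  fraction \<open>1/2 + \<epsilon>\<close> of the cube, satisfies \<open>\<epsilon> N \<le> 1 + d\<close> as soon as every member agrees on more
  than a quarter of the cube with at most \<open>d\<close> others. If the difference \<open>D\<close> of two members vanishes
  on more than a quarter of the cube, then its nonzero coefficients are all \<open>v\<close> or \<open>-v\<close> for a
  single group element \<open>v\<close>: two coefficients \<open>a\<close>, \<open>b\<close> violating this give four distinct values
  \<open>0, a, b, a + b\<close>. There are then three kinds of neighbours.

  If \<open>v\<close> has order at least 5, then \<open>D\<close> has at most 16 nonzero coefficients, by inspection of the
  binomial coefficients of 9. Sparse functions are counted by a sunflower argument: off a common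
  core, functions with disjoint supports are independent, so by a variance estimate a single \<open>f\<close>
  cannot agree with many of them on noticeably more than half of the cube.

  If \<open>v\<close> has order 2 or 3, the list lives in a group of exponent 2 or 3. Applying the Johnson count
  a second time inside the neighbourhood of one function, two adjacent differences \<open>v l\<close> and \<open>w l'\<close>
  either generate the same cyclic group, which is handled by counting agreeing pairs of functions
  with two or three values, or have \<open>l = l'\<close> up to sign, and then they agree only where \<open>l\<close> vanishes.

  Order 4 reduces to exponent 2 by doubling: both the doubled list and the fibres of the doubling
  map have exponent 2.

  Since the polynomial in the statement is chosen by means of groups on the natural numbers, the
  result is finally carried over from the countable subgroup generated by all the data.
\<close>

section \<open>Counting subsets and pairs\<close>

lemma card_eq_sum_of_bool:
  "finite A \<Longrightarrow> real (card {x \<in> A. R x}) = (\<Sum>x\<in>A. of_bool (R x))"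
  by (simp add: sum.If_cases of_bool_def Int_def)

text \<open>Fubini for the cube: the coordinates outside \<open>T\<close> are frozen as
  \<open>Y\<close>, those in \<open>T\<close> vary as \<open>U\<close>. The density estimates below
  bound the count on each such fibre.\<close>

lemma card_subsets_fibre:
  assumes "finite I" "T \<subseteq> I"
  shows "card {X. X \<subseteq> I \<and> R X} = (\<Sum>Y\<in>Pow (I - T). card {U. U \<subseteq> T \<and> R (Y \<union> U)})"
proof -
  have fT: "finite T" "finite (I - T)" using assms finite_subset by auto
  have "bij_betw (\<lambda>(Y, U). Y \<union> U) (SIGMA Y:Pow (I - T). {U. U \<subseteq> T \<and> R (Y \<union> U)}) {X. X \<subseteq> I \<and> R X}"
  proof (rule bij_betw_byWitness[where f' = "\<lambda>X. (X - T, X \<inter> T)"])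
    show "(\<lambda>X. (X - T, X \<inter> T)) ` {X. X \<subseteq> I \<and> R X} \<subseteq> (SIGMA Y:Pow (I - T). {U. U \<subseteq> T \<and> R (Y \<union> U)})"
      by (auto simp: Un_Diff_Int)
  qed (use assms(2) in auto)
  then show ?thesis using fT by (auto simp: bij_betw_same_card[symmetric] card_SigmaI)
qed

lemma card_subsets_fibre_le:
  assumes "finite I" "T \<subseteq> I"
    and "\<And>Y. Y \<subseteq> I - T \<Longrightarrow> card {U. U \<subseteq> T \<and> R (Y \<union> U)} \<le> c"
  shows "card {X. X \<subseteq> I \<and> R X} \<le> c * 2 ^ card (I - T)"
  using sum_bounded_above[of "Pow (I - T)" "\<lambda>Y. card {U. U \<subseteq> T \<and> R (Y \<union> U)}" c] assms
  by (simp add: card_subsets_fibre card_Pow mult.commute)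

lemma card_subsets_eq: "finite A \<Longrightarrow> card {U. U \<subseteq> A} = 2 ^ card A"
  using card_Pow[of A] by (simp add: Pow_def)

lemma card_subsets_product:
  assumes "finite I" "Z \<subseteq> I"
  shows "card {W. W \<subseteq> I \<and> g (W \<inter> Z) \<and> h (W - Z)}
      = card {U. U \<subseteq> Z \<and> g U} * card {V. V \<subseteq> I - Z \<and> h V}"
proof -
  have "bij_betw (\<lambda>W. (W \<inter> Z, W - Z)) {W. W \<subseteq> I \<and> g (W \<inter> Z) \<and> h (W - Z)}
      ({U. U \<subseteq> Z \<and> g U} \<times> {V. V \<subseteq> I - Z \<and> h V})"
  proof (rule bij_betw_byWitness[where f' = "\<lambda>(U, V). U \<union> V"])
    show "(\<lambda>(U, V). U \<union> V) ` ({U. U \<subseteq> Z \<and> g U} \<times> {V. V \<subseteq> I - Z \<and> h V})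
        \<subseteq> {W. W \<subseteq> I \<and> g (W \<inter> Z) \<and> h (W - Z)}"
    proof clarsimp
      fix U V assume *: "U \<subseteq> Z" "g U" "V \<subseteq> I - Z" "h V"
      then have "(U \<union> V) \<inter> Z = U" "U \<union> V - Z = V" by auto
      with * assms(2) show "U \<subseteq> I \<and> V \<subseteq> I \<and> g ((U \<union> V) \<inter> Z) \<and> h (U \<union> V - Z)" by auto
    qed
  qed auto
  then show ?thesis by (simp add: bij_betw_same_card card_cartesian_product)
qed

lemma card_subsets_depends:
  assumes "finite I" "Z \<subseteq> I" and "\<And>W. W \<subseteq> I \<Longrightarrow> g W = g (W \<inter> Z)"
  shows "card {W. W \<subseteq> I \<and> g W} = card {U. U \<subseteq> Z \<and> g U} * 2 ^ card (I - Z)"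
proof -
  have "{W. W \<subseteq> I \<and> g W} = {W. W \<subseteq> I \<and> g (W \<inter> Z) \<and> True}" using assms(3) by blast
  then show ?thesis
    using card_subsets_product[OF assms(1,2), of g "\<lambda>_. True"] assms(1) by (simp add: card_subsets_eq)
qed

lemma two_power_card_split:
  "finite I \<Longrightarrow> Z \<subseteq> I \<Longrightarrow> (2::'b::comm_semiring_1) ^ card I = 2 ^ card Z * 2 ^ card (I - Z)"
  using card_Diff_subset[of Z I] card_mono[of I Z] finite_subset[of Z I]
  by (simp add: power_add[symmetric])

text \<open>Under the uniform measure, an event that looks only at coordinates inside
  \<open>Z\<close> is independent of one that looks only outside \<open>Z\<close>; denominators are
  cleared to stay within the natural numbers.\<close>

lemma card_subsets_independent:
  assumes "finite I" "Z \<subseteq> I"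
    and g: "\<And>W. W \<subseteq> I \<Longrightarrow> g W = g (W \<inter> Z)" and h: "\<And>W. W \<subseteq> I \<Longrightarrow> h W = h (W - Z)"
  shows "card {W. W \<subseteq> I \<and> g W \<and> h W} * 2 ^ card I
       = card {W. W \<subseteq> I \<and> g W} * card {W. W \<subseteq> I \<and> h W}"
proof -
  have "{W. W \<subseteq> I \<and> g W \<and> h W} = {W. W \<subseteq> I \<and> g (W \<inter> Z) \<and> h (W - Z)}"
    "{W. W \<subseteq> I \<and> h W} = {W. W \<subseteq> I \<and> True \<and> h (W - Z)}"
    using g h by blast+
  then show ?thesis
    using card_subsets_product[OF assms(1,2), of g h] card_subsets_depends[where g = g, OF assms(1,2) g]
      card_subsets_product[OF assms(1,2), of "\<lambda>_. True" h] finite_subset[OF assms(2,1)]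
    by (simp add: card_subsets_eq two_power_card_split[OF assms(1,2)])
qed

section \<open>Johnson-type double counting\<close>

text \<open>In row \<open>i\<close> the diagonal entry and the at most \<open>d\<close> heavy
  entries cost \<open>W\<close> each, and every entry is charged \<open>\<theta>\<close> on
  top.\<close>

lemma pair_sum_le:
  fixes \<alpha> :: "'b \<Rightarrow> 'b \<Rightarrow> real" and W \<theta> d :: real
  assumes "finite J" and W: "\<And>i j. \<alpha> i j \<le> W" "0 \<le> W" and "0 \<le> \<theta>"
    and d: "\<And>i. i \<in> J \<Longrightarrow> real (card {j \<in> J. j \<noteq> i \<and> \<theta> < \<alpha> i j}) \<le> d"
  shows "(\<Sum>i\<in>J. \<Sum>j\<in>J. \<alpha> i j) \<le> card J * (W * (1 + d) + \<theta> * card J)"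
proof -
  have "(\<Sum>j\<in>J. \<alpha> i j) \<le> W * (1 + d) + \<theta> * card J" if i: "i \<in> J" for i
  proof -
    have "(\<Sum>j\<in>J. \<alpha> i j) \<le> (\<Sum>j\<in>J. W * of_bool (j = i) + W * of_bool (j \<noteq> i \<and> \<theta> < \<alpha> i j) + \<theta>)"
      using W \<open>0 \<le> \<theta>\<close> by (intro sum_mono) (auto simp: of_bool_def add_increasing2)
    also have "\<dots> = W * real (card {j \<in> J. j = i}) + W * real (card {j \<in> J. j \<noteq> i \<and> \<theta> < \<alpha> i j}) + \<theta> * card J"
      unfolding card_eq_sum_of_bool[OF \<open>finite J\<close>] by (simp add: sum.distrib sum_distrib_left)
    also have "{j \<in> J. j = i} = {i}" using i by auto
    also have "W * real (card {i}) + W * real (card {j \<in> J. j \<noteq> i \<and> \<theta> < \<alpha> i j}) + \<theta> * card J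
        \<le> W * (1 + d) + \<theta> * card J"
      using mult_left_mono[OF d[OF i] W(2)] by (simp add: distrib_left)
    finally show ?thesis .
  qed
  then show ?thesis using sum_bounded_above[of J "\<lambda>i. \<Sum>j\<in>J. \<alpha> i j"] by simp
qed

lemma sum_pairs_card:
  assumes "finite J" "finite \<Omega>"
  shows "(\<Sum>i\<in>J. \<Sum>j\<in>J. real (card {x \<in> \<Omega>. R i j x}))
       = (\<Sum>x\<in>\<Omega>. \<Sum>i\<in>J. \<Sum>j\<in>J. of_bool (R i j x))"
proof -
  have "(\<Sum>i\<in>J. \<Sum>j\<in>J. real (card {x \<in> \<Omega>. R i j x}))
      = (\<Sum>i\<in>J. \<Sum>x\<in>\<Omega>. \<Sum>j\<in>J. of_bool (R i j x))"
    unfolding card_eq_sum_of_bool[OF assms(2)] by (intro sum.cong refl sum.swap)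
  also have "\<dots> = (\<Sum>x\<in>\<Omega>. \<Sum>i\<in>J. \<Sum>j\<in>J. of_bool (R i j x))"
    by (rule sum.swap)
  finally show ?thesis .
qed

text \<open>Let \<open>c x\<close> count the indices with \<open>R i x\<close>. Its second moment
  counts pairs: it is at least \<open>W * m^2\<close> because the mean of \<open>c\<close> is at
  least \<open>m = (1/2 + \<epsilon>) * N\<close>, and \<open>pair_sum_le\<close> with threshold
  \<open>W / 4\<close> bounds it from above. The terms \<open>N / 4\<close> cancel, which leaves the
  term linear in \<open>\<epsilon>\<close>.\<close>

lemma johnson_degree:
  fixes R :: "'b \<Rightarrow> 'x \<Rightarrow> bool" and \<epsilon> d :: real
  assumes fin: "finite \<Omega>" "\<Omega> \<noteq> {}" "finite J"
    and big: "\<And>i. i \<in> J \<Longrightarrow> (1/2 + \<epsilon>) * card \<Omega> \<le> card {x \<in> \<Omega>. R i x}" and "0 < \<epsilon>"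
    and deg: "\<And>i. i \<in> J \<Longrightarrow>
      real (card {j \<in> J. j \<noteq> i \<and> card \<Omega> < 4 * card {x \<in> \<Omega>. R i x \<and> R j x}}) \<le> d"
    and "0 \<le> d"
  shows "\<epsilon> * card J \<le> 1 + d"
proof (cases "J = {}")
  case False
  define N where "N = real (card J)"
  define W where "W = real (card \<Omega>)"
  define c where "c x = (\<Sum>i\<in>J. of_bool (R i x) :: real)" for x
  define m where "m = (1/2 + \<epsilon>) * N"
  have N: "N > 0" and W: "W > 0" using fin False by (auto simp: N_def W_def card_gt_0_iff)
  have sc: "(\<Sum>x\<in>\<Omega>. c x) \<ge> W * m"
  proof -
    have "(\<Sum>x\<in>\<Omega>. c x) = (\<Sum>i\<in>J. real (card {x \<in> \<Omega>. R i x}))"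
      unfolding c_def card_eq_sum_of_bool[OF fin(1)] by (rule sum.swap)
    also have "\<dots> \<ge> (\<Sum>i\<in>J. (1/2 + \<epsilon>) * W)" using big unfolding W_def by (intro sum_mono) auto
    finally show ?thesis by (simp add: m_def N_def mult.commute mult.left_commute)
  qed
  \<comment> \<open>The tangent of the square at \<open>m\<close> replaces Cauchy-Schwarz: as
    \<open>m\<close> is nonnegative, a lower bound on the sum of \<open>c\<close> suffices.\<close>
  have "W * m\<^sup>2 = 2 * m * (W * m) - W * m\<^sup>2" by (simp add: power2_eq_square)
  also have "\<dots> \<le> 2 * m * (\<Sum>x\<in>\<Omega>. c x) - W * m\<^sup>2"
    using sc N \<open>0 < \<epsilon>\<close> by (simp add: m_def)
  also have "\<dots> = (\<Sum>x\<in>\<Omega>. 2 * m * c x - m\<^sup>2)" by (simp add: sum_subtractf sum_distrib_left W_def)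
  also have "\<dots> \<le> (\<Sum>x\<in>\<Omega>. (c x)\<^sup>2)"
  proof (intro sum_mono)
    fix x show "2 * m * c x - m\<^sup>2 \<le> (c x)\<^sup>2"
      using zero_le_power2[of "c x - m"] by (simp add: power2_diff algebra_simps)
  qed
  also have "\<dots> = (\<Sum>i\<in>J. \<Sum>j\<in>J. real (card {x \<in> \<Omega>. R i x \<and> R j x}))"
    unfolding sum_pairs_card[OF fin(3) fin(1)]
    by (simp add: c_def power2_eq_square sum_product of_bool_conj)
  also have "\<dots> \<le> card J * (W * (1 + d) + (W / 4) * card J)"
  proof (rule pair_sum_le)
    fix i j show "real (card {x \<in> \<Omega>. R i x \<and> R j x}) \<le> W"
      unfolding W_def using fin by (auto intro!: card_mono)
  next
    fix i assume "i \<in> J"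
    have "(W / 4 < real (card {x \<in> \<Omega>. R i x \<and> R j x}))
        \<longleftrightarrow> card \<Omega> < 4 * card {x \<in> \<Omega>. R i x \<and> R j x}" for j
      unfolding W_def by linarith
    then show "real (card {j \<in> J. j \<noteq> i \<and> W / 4 < real (card {x \<in> \<Omega>. R i x \<and> R j x})}) \<le> d"
      using deg[OF \<open>i \<in> J\<close>] by simp
  qed (use fin W in auto)
  finally have "W * m\<^sup>2 \<le> W * (N * (1 + d + N / 4))" unfolding N_def by (simp add: algebra_simps)
  then have "m\<^sup>2 \<le> N * (1 + d + N / 4)" using W by simp
  moreover have "m\<^sup>2 = N * (N / 4 + \<epsilon> * N + \<epsilon>\<^sup>2 * N)"
    by (simp add: m_def power2_eq_square algebra_simps)
  ultimately have "N / 4 + \<epsilon> * N + \<epsilon>\<^sup>2 * N \<le> 1 + d + N / 4" using N by simp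
  moreover have "\<epsilon>\<^sup>2 * N \<ge> 0" using N by simp
  ultimately show ?thesis unfolding N_def by linarith
qed (use \<open>0 \<le> d\<close> in simp)

section \<open>Affine functions on a power set\<close>

text \<open>A point of the cube is encoded as the set of its coordinates equal to 1; the group is written
  multiplicatively, so \<open>slope P i\<close> is the coefficient of the \<open>i\<close>-th variable.\<close>

context comm_group
begin

definition slope :: "('i set \<Rightarrow> 'a) \<Rightarrow> 'i \<Rightarrow> 'a" where
  "slope P i = inv (P {}) \<otimes> P {i}"

text \<open>Affinity is stated through single-coordinate increments instead of a product over
  coordinates, so that proofs go by induction on the point. The extensional function space makes
  equality of members mean equality on \<open>Pow I\<close>.\<close>

definition affine_on :: "'i set \<Rightarrow> ('i set \<Rightarrow> 'a) set" where
  "affine_on I = {P \<in> Pow I \<rightarrow>\<^sub>E carrier G.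
     \<forall>X i. X \<subseteq> I \<longrightarrow> i \<in> I \<longrightarrow> i \<notin> X \<longrightarrow> P (insert i X) = P X \<otimes> slope P i}"

definition support :: "'i set \<Rightarrow> ('i set \<Rightarrow> 'a) \<Rightarrow> 'i set" where
  "support I P = {i \<in> I. slope P i \<noteq> \<one>}"

definition affine_div :: "'i set \<Rightarrow> ('i set \<Rightarrow> 'a) \<Rightarrow> ('i set \<Rightarrow> 'a) \<Rightarrow> 'i set \<Rightarrow> 'a" where
  "affine_div I P Q = restrict (\<lambda>X. P X \<otimes> inv (Q X)) (Pow I)"

definition affine_pow :: "'i set \<Rightarrow> nat \<Rightarrow> ('i set \<Rightarrow> 'a) \<Rightarrow> 'i set \<Rightarrow> 'a" where
  "affine_pow I k P = restrict (\<lambda>X. P X [^] k) (Pow I)"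

section \<open>Arithmetic of affine functions\<close>

lemma inv_mult_cancel: "x \<in> carrier G \<Longrightarrow> y \<in> carrier G \<Longrightarrow> inv x \<otimes> (x \<otimes> y) = y"
  using m_assoc[of "inv x" x y] by simp

lemma mult_inv_eq_one_iff:
  "x \<in> carrier G \<Longrightarrow> y \<in> carrier G \<Longrightarrow> x \<otimes> inv y = \<one> \<longleftrightarrow> x = y"
  using inv_equality[of x "inv y"] by auto

lemma affine_closed: "P \<in> affine_on I \<Longrightarrow> X \<subseteq> I \<Longrightarrow> P X \<in> carrier G"
  by (auto simp: affine_on_def)

lemma slope_closed [simp]: "P \<in> affine_on I \<Longrightarrow> i \<in> I \<Longrightarrow> slope P i \<in> carrier G"
  using affine_closed[of P I "{}"] affine_closed[of P I "{i}"] by (simp add: slope_def)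

lemma affine_insert:
  "P \<in> affine_on I \<Longrightarrow> X \<subseteq> I \<Longrightarrow> i \<in> I \<Longrightarrow> i \<notin> X \<Longrightarrow> P (insert i X) = P X \<otimes> slope P i"
  by (simp add: affine_on_def)

lemma affine_eqI:
  "P \<in> affine_on I \<Longrightarrow> Q \<in> affine_on I \<Longrightarrow> (\<And>X. X \<subseteq> I \<Longrightarrow> P X = Q X) \<Longrightarrow> P = Q"
  by (rule PiE_ext[of P "Pow I" "\<lambda>_. carrier G" Q]) (auto simp: affine_on_def)

text \<open>Evaluating the increment equation at \<open>X = {}\<close> identifies the given
  \<open>a\<close> with the slopes, so one verification yields both conclusions.\<close>

lemma affine_onI:
  assumes "P \<in> Pow I \<rightarrow>\<^sub>E carrier G" "\<And>i. i \<in> I \<Longrightarrow> a i \<in> carrier G"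
    and "\<And>X i. X \<subseteq> I \<Longrightarrow> i \<in> I \<Longrightarrow> i \<notin> X \<Longrightarrow> P (insert i X) = P X \<otimes> a i"
  shows "P \<in> affine_on I" "\<And>i. i \<in> I \<Longrightarrow> slope P i = a i"
proof -
  show s: "slope P i = a i" if "i \<in> I" for i
    using assms(3)[of "{}" i] that assms(2) PiE_mem[OF assms(1), of "{}"] by (auto simp: slope_def inv_mult_cancel)
  show "P \<in> affine_on I" using assms s by (auto simp: affine_on_def)
qed

lemma affine_div_apply: "X \<subseteq> I \<Longrightarrow> affine_div I P Q X = P X \<otimes> inv (Q X)"
  by (simp add: affine_div_def)

lemma affine_div:
  assumes "P \<in> affine_on I" "Q \<in> affine_on I"
  shows affine_div_affine: "affine_div I P Q \<in> affine_on I"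
    and slope_affine_div: "\<And>i. i \<in> I \<Longrightarrow> slope (affine_div I P Q) i = slope P i \<otimes> inv (slope Q i)"
proof -
  have "affine_div I P Q (insert i X) = affine_div I P Q X \<otimes> (slope P i \<otimes> inv (slope Q i))"
    if "X \<subseteq> I" "i \<in> I" "i \<notin> X" for X i
    using that assms affine_insert[of P I X i] affine_insert[of Q I X i]
      affine_closed[of P I X] affine_closed[of Q I X]
    by (simp add: affine_div_apply inv_mult m_ac)
  moreover have "affine_div I P Q \<in> Pow I \<rightarrow>\<^sub>E carrier G"
    using assms by (auto simp: affine_div_def affine_closed)
  moreover have "slope P i \<otimes> inv (slope Q i) \<in> carrier G" if "i \<in> I" for i
    using assms that by simp
  ultimately show "affine_div I P Q \<in> affine_on I"
    "\<And>i. i \<in> I \<Longrightarrow> slope (affine_div I P Q) i = slope P i \<otimes> inv (slope Q i)"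
    using affine_onI[of "affine_div I P Q" I "\<lambda>i. slope P i \<otimes> inv (slope Q i)"] by blast+
qed

lemma affine_div_eq_one_iff:
  assumes "P \<in> affine_on I" "Q \<in> affine_on I" "X \<subseteq> I"
  shows "affine_div I P Q X = \<one> \<longleftrightarrow> P X = Q X"
  using assms affine_closed[of P I X] affine_closed[of Q I X]
  by (simp add: affine_div_apply mult_inv_eq_one_iff)

lemma affine_div_inj: "Q \<in> affine_on I \<Longrightarrow> inj_on (\<lambda>P. affine_div I P Q) (affine_on I)"
proof (rule inj_onI)
  fix P P' assume *: "Q \<in> affine_on I" "P \<in> affine_on I" "P' \<in> affine_on I"
    "affine_div I P Q = affine_div I P' Q"
  have "P X = P' X" if "X \<subseteq> I" for X
    using that fun_cong[OF *(4), of X] *(1-3)[THEN affine_closed, OF that]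
    by (simp add: affine_div_apply)
  then show "P = P'" using affine_eqI * by blast
qed

lemma affine_pow:
  assumes "P \<in> affine_on I"
  shows "affine_pow I k P \<in> affine_on I"
proof (rule affine_onI)
  show "affine_pow I k P \<in> Pow I \<rightarrow>\<^sub>E carrier G" using assms by (auto simp: affine_pow_def affine_closed)
  show "slope P i [^] k \<in> carrier G" if "i \<in> I" for i using assms that by simp
  show "affine_pow I k P (insert i X) = affine_pow I k P X \<otimes> slope P i [^] k"
    if "X \<subseteq> I" "i \<in> I" "i \<notin> X" for X i
    using that assms affine_insert[of P I X i] affine_closed[of P I X]
    by (simp add: affine_pow_def nat_pow_distrib)
qed

lemma affine_union_pow:
  assumes P: "P \<in> affine_on I" and "finite U" "U \<inter> Y = {}" "Y \<union> U \<subseteq> I"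
    and v: "v \<in> carrier G" "\<And>i. i \<in> U \<Longrightarrow> slope P i = v"
  shows "P (Y \<union> U) = P Y \<otimes> v [^] card U"
  using assms(2-4) v(2)
proof (induction U)
  case empty
  then show ?case using affine_closed[OF P, of Y] by simp
next
  case (insert i U)
  then have "P (insert i (Y \<union> U)) = P (Y \<union> U) \<otimes> v"
    using affine_insert[OF P, of "Y \<union> U" i] by auto
  then show ?case using insert affine_closed[OF P, of Y] v by (simp add: m_assoc)
qed

lemma affine_depends_on_support:
  assumes P: "P \<in> affine_on I" and "finite I" "support I P \<subseteq> S" "X \<subseteq> I"
  shows "P X = P (X \<inter> S)"
proof -
  have "P ((X \<inter> S) \<union> (X - S)) = P (X \<inter> S) \<otimes> \<one> [^] card (X - S)"
    using assms by (intro affine_union_pow) (auto simp: support_def intro: finite_subset)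
  moreover have "(X \<inter> S) \<union> (X - S) = X" by blast
  moreover have "P (X \<inter> S) \<in> carrier G" using P \<open>X \<subseteq> I\<close> by (intro affine_closed) auto
  ultimately show ?thesis by simp
qed

section \<open>How often an affine function takes a given value\<close>

lemma affine_value_half:
  assumes P: "P \<in> affine_on I" and "finite I" "A \<subseteq> I" "B \<subseteq> I" "A \<inter> B = {}"
    and i: "i \<in> A" "slope P i \<noteq> \<one>"
  shows "2 * card {W. W \<subseteq> A \<and> P (B \<union> W) = v} \<le> 2 ^ card A"
proof -
  have fA: "finite A" using assms finite_subset by blast
  have "card {W. W \<subseteq> A \<and> P (B \<union> W) = v} \<le> 1 * 2 ^ card (A - {i})"
  proof (rule card_subsets_fibre_le)
    fix Y assume Y: "Y \<subseteq> A - {i}"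
    have ins: "P (insert i (B \<union> Y)) = P (B \<union> Y) \<otimes> slope P i"
      using affine_insert[OF P, of "B \<union> Y" i] Y i assms by auto
    have c: "P (B \<union> Y) \<in> carrier G" "slope P i \<in> carrier G"
      using affine_closed[OF P, of "B \<union> Y"] slope_closed[OF P, of i] Y i assms by auto
    have "U = V" if "U \<subseteq> {i}" "V \<subseteq> {i}" "P (B \<union> (Y \<union> U)) = v" "P (B \<union> (Y \<union> V)) = v" for U V
      using that ins i c by (auto simp: subset_singleton_iff)
    then show "card {U. U \<subseteq> {i} \<and> P (B \<union> (Y \<union> U)) = v} \<le> 1"
      by (subst card_le_Suc0_iff_eq[unfolded One_nat_def[symmetric]]) auto
  qed (use i fA in auto)
  moreover have "2 ^ card A = 2 * (2::nat) ^ card (A - {i})"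
    using i fA by (metis card_Suc_Diff1 power_Suc)
  ultimately show ?thesis by simp
qed

text \<open>The Schwartz-Zippel bound in degree one: a function with a nontrivial slope is covered
  by pairing points along that coordinate, and a constant other than one is never one.\<close>

lemma affine_half:
  assumes D: "D \<in> affine_on I" and "finite I" and ne: "\<exists>X\<subseteq>I. D X \<noteq> \<one>"
  shows "2 * card {X. X \<subseteq> I \<and> D X = \<one>} \<le> 2 ^ card I"
proof (cases "support I D = {}")
  case True
  then have "D X = D {}" if "X \<subseteq> I" for X
    using affine_depends_on_support[OF D \<open>finite I\<close>, of "{}" X] that by simp
  then have no: "{X. X \<subseteq> I \<and> D X = \<one>} = {}" using ne by (metis (mono_tags, lifting) Collect_empty_eq)
  show ?thesis unfolding no by simp
next
  case False
  then obtain i where i: "i \<in> I" "slope D i \<noteq> \<one>" by (auto simp: support_def)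
  then show ?thesis using affine_value_half[OF D \<open>finite I\<close>, of I "{}" i \<one>] by simp
qed

text \<open>Take a nontrivial slope \<open>v\<close> and suppose that another slope \<open>w\<close>
  is neither one nor \<open>v\<close> nor \<open>inv v\<close>. Freezing all coordinates but these
  two leaves four distinct values, at most one of which is one. Hence the density would be at most a
  quarter.\<close>

lemma affine_quarter:
  assumes D: "D \<in> affine_on I" and "finite I" and "2 ^ card I < 4 * card {X. X \<subseteq> I \<and> D X = \<one>}"
  obtains v where "v \<in> carrier G" "\<And>i. i \<in> I \<Longrightarrow> slope D i \<in> {\<one>, v, inv v}"
proof (cases "support I D = {}")
  case True
  then show ?thesis using that[of \<one>] by (auto simp: support_def)
next
  case False
  then obtain i where i: "i \<in> I" "slope D i \<noteq> \<one>" by (auto simp: support_def)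
  define v where "v = slope D i"
  have v: "v \<in> carrier G" using D i by (simp add: v_def)
  have "slope D j \<in> {\<one>, v, inv v}" if j: "j \<in> I" for j
  proof (rule ccontr)
    define w where "w = slope D j"
    assume nin: "slope D j \<notin> {\<one>, v, inv v}"
    then have w: "w \<in> carrier G" "w \<noteq> \<one>" "w \<noteq> v" "w \<noteq> inv v" "v \<noteq> \<one>" "i \<noteq> j"
      using D j i by (auto simp: w_def v_def)
    have "card {X. X \<subseteq> I \<and> D X = \<one>} \<le> 1 * 2 ^ card (I - {i, j})"
    proof (rule card_subsets_fibre_le)
      fix Y assume Y: "Y \<subseteq> I - {i, j}"
      define g where "g = D Y"
      have g: "g \<in> carrier G" using affine_closed[OF D, of Y] Y by (auto simp: g_def)
      have "D (insert i Y) = g \<otimes> v" "D (insert j Y) = g \<otimes> w"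
        using affine_insert[OF D, of Y i] affine_insert[OF D, of Y j] Y i j by (auto simp: g_def v_def w_def)
      moreover have "D (insert i (insert j Y)) = g \<otimes> w \<otimes> v"
        using affine_insert[OF D, of "insert j Y" i] calculation Y i j w by (auto simp: v_def)
      ultimately have vals: "D (Y \<union> {}) = g" "D (Y \<union> {i}) = g \<otimes> v" "D (Y \<union> {j}) = g \<otimes> w"
        "D (Y \<union> {i, j}) = g \<otimes> w \<otimes> v" by (simp_all add: g_def)
      have wv: "w \<otimes> v \<noteq> \<one>" using w v by (metis inv_equality)
      \<comment> \<open>No two of \<open>g\<close>, \<open>g v\<close>, \<open>g w\<close>,
        \<open>g w v\<close> can both be one: these five implications together with the next fact
        cover all six pairs.\<close>
      have one: "g = \<one> \<Longrightarrow> g \<otimes> v \<noteq> \<one>" "g = \<one> \<Longrightarrow> g \<otimes> w \<noteq> \<one>" "g = \<one> \<Longrightarrow> g \<otimes> w \<otimes> v \<noteq> \<one>"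
        "g \<otimes> v = \<one> \<Longrightarrow> g \<otimes> w \<noteq> \<one>" "g \<otimes> w = \<one> \<Longrightarrow> g \<otimes> w \<otimes> v \<noteq> \<one>"
        using wv w v g Units_l_cancel[of g v w] by (auto simp: m_assoc)
      have "g \<otimes> v = \<one> \<Longrightarrow> g \<otimes> w \<otimes> v \<noteq> \<one>"
        using w v g m_comm[of w v] m_assoc[of g v w] by (auto simp: m_assoc[of g w v])
      note one = one this
      have sub: "U \<in> {{}, {i}, {j}, {i, j}}" if "U \<subseteq> {i, j}" for U
        using that by auto
      have "U = V" if "U \<subseteq> {i, j}" "V \<subseteq> {i, j}" "D (Y \<union> U) = \<one>" "D (Y \<union> V) = \<one>" for U V
        using sub[OF that(1)] sub[OF that(2)] that(3,4) unfolding insert_iff empty_iff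
        by (elim disjE; simp only: vals; metis one)
      then show "card {U. U \<subseteq> {i, j} \<and> D (Y \<union> U) = \<one>} \<le> 1"
        by (subst card_le_Suc0_iff_eq[unfolded One_nat_def[symmetric]]) auto
    qed (use i j assms in auto)
    moreover have "2 ^ card I = 4 * (2::nat) ^ card (I - {i, j})"
    proof -
      have "card I = 2 + card (I - {i, j})"
        using i j w \<open>finite I\<close> card_Diff_subset[of "{i, j}" I] card_mono[of I "{i, j}"] by auto
      then show ?thesis by (simp add: power_add)
    qed
    ultimately show False using assms(3) by simp
  qed
  then show ?thesis using that v by blast
qed

section \<open>Many equal slopes and binomial coefficients\<close>

text \<open>The condition depends on \<open>U\<close> only through its size, so the subsets are
  grouped by size. Writing the good sizes as an indicator lets the binomial lemmas below speak of an
  arbitrary predicate with gaps.\<close>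

lemma card_subsets_pow_eq_one:
  assumes "finite T"
  shows "card {U. U \<subseteq> T \<and> h \<otimes> v [^] card U = \<one>}
       = (\<Sum>j\<le>card T. of_bool (h \<otimes> v [^] j = \<one>) * (card T choose j))"
proof -
  have "{U. U \<subseteq> T \<and> h \<otimes> v [^] card U = \<one>}
      = (\<Union>j\<in>{j. j \<le> card T \<and> h \<otimes> v [^] j = \<one>}. {U. U \<subseteq> T \<and> card U = j})"
    using assms by (auto intro: card_mono)
  also have "card \<dots> = (\<Sum>j\<in>{j. j \<le> card T \<and> h \<otimes> v [^] j = \<one>}. card {U. U \<subseteq> T \<and> card U = j})"
    using assms by (intro card_UN_disjoint) auto
  also have "\<dots> = (\<Sum>j\<in>{j \<in> {..card T}. h \<otimes> v [^] j = \<one>}. card T choose j)"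
    using n_subsets[OF assms] by (intro sum.cong) auto
  also have "\<dots> = (\<Sum>j\<le>card T. of_bool (h \<otimes> v [^] j = \<one>) * (card T choose j))"
    by (subst sum.inter_filter) (auto intro!: sum.cong simp: of_bool_def)
  finally show ?thesis .
qed

text \<open>Dividing the two equations gives \<open>v [^] (k - j) = \<one>\<close>, so the positive
  number \<open>k - j\<close> cannot be below \<open>q\<close>.\<close>

lemma pow_gap:
  fixes j k q :: nat
  assumes "v \<in> carrier G" "h \<in> carrier G" and ord: "\<And>k. 1 \<le> k \<Longrightarrow> k < q \<Longrightarrow> v [^] k \<noteq> \<one>"
    and "h \<otimes> v [^] j = \<one>" "h \<otimes> v [^] k = \<one>" "j < k"
  shows "j + q \<le> k"
proof (rule ccontr)
  assume "\<not> j + q \<le> k"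
  then have "1 \<le> k - j" "k - j < q" using \<open>j < k\<close> by auto
  moreover have "v [^] (k - j) = \<one>"
  proof -
    have "v [^] k = v [^] j \<otimes> v [^] (k - j)" using assms by (simp add: nat_pow_mult)
    then have "(h \<otimes> v [^] j) \<otimes> v [^] (k - j) = \<one>" using assms by (metis m_assoc nat_pow_closed)
    then show ?thesis using assms by simp
  qed
  ultimately show False using ord by blast
qed

text \<open>On a fibre over \<open>T\<close> the value is \<open>D Y\<close> times
  \<open>v [^] card U\<close>. By \<open>pow_gap\<close> the sizes for which this is one are at
  least \<open>q\<close> apart, so the assumed bound on sums of binomial coefficients applies to
  every fibre.\<close>

lemma affine_fibre_pow:
  assumes D: "D \<in> affine_on I" and "finite I" "T \<subseteq> I" "v \<in> carrier G"
    and slope: "\<And>i. i \<in> T \<Longrightarrow> slope D i = v"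
    and ord: "\<And>k. 1 \<le> k \<Longrightarrow> k < q \<Longrightarrow> v [^] k \<noteq> \<one>"
    and bound: "\<And>b. (\<And>j k. b j \<Longrightarrow> b k \<Longrightarrow> j < k \<Longrightarrow> j + q \<le> k) \<Longrightarrow>
        (\<Sum>j\<le>card T. of_bool (b j) * (card T choose j)) \<le> c"
  shows "2 ^ card T * card {X. X \<subseteq> I \<and> D X = \<one>} \<le> c * 2 ^ card I"
proof -
  have fT: "finite T" using assms finite_subset by blast
  have "card {X. X \<subseteq> I \<and> D X = \<one>} \<le> c * 2 ^ card (I - T)"
  proof (rule card_subsets_fibre_le)
    fix Y assume Y: "Y \<subseteq> I - T"
    then have DY: "D Y \<in> carrier G" using affine_closed[OF D, of Y] by blast
    have "D (Y \<union> U) = D Y \<otimes> v [^] card U" if "U \<subseteq> T" for U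
      using that Y assms slope finite_subset[OF that fT] by (intro affine_union_pow[OF D]) auto
    then have "{U. U \<subseteq> T \<and> D (Y \<union> U) = \<one>} = {U. U \<subseteq> T \<and> D Y \<otimes> v [^] card U = \<one>}" by auto
    then show "card {U. U \<subseteq> T \<and> D (Y \<union> U) = \<one>} \<le> c"
      using bound[of "\<lambda>j. D Y \<otimes> v [^] j = \<one>"] pow_gap[OF \<open>v \<in> carrier G\<close> DY ord]
      by (simp add: card_subsets_pow_eq_one[OF fT])
  qed (use assms in auto)
  moreover have "card I = card T + card (I - T)"
    using assms fT card_Diff_subset[of T I] card_mono[of I T] by simp
  ultimately show ?thesis by (simp add: power_add)
qed

end

text \<open>The number 128 is a quarter of \<open>2 ^ 9\<close>, the density that a neighbour must
  exceed. Eight coordinates would be too few: the central coefficient 70 alone exceeds a quarter of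
  \<open>2 ^ 8\<close>.\<close>

lemma binomial_9_gap_5:
  fixes b :: "nat \<Rightarrow> bool"
  assumes gap: "\<And>j k. b j \<Longrightarrow> b k \<Longrightarrow> j < k \<Longrightarrow> j + 5 \<le> k"
  shows "(\<Sum>j\<le>9. of_bool (b j) * (9 choose j)) \<le> (128::nat)"
proof -
  \<comment> \<open>Five consecutive indices contain at most one solution; linear arithmetic over
    the six windows then bounds the weighted sum.\<close>
  have window: "of_bool (b t) + of_bool (b (t + 1)) + of_bool (b (t + 2)) + of_bool (b (t + 3))
      + of_bool (b (t + 4)) \<le> (1::nat)" for t
    using gap[of t "t + 1"] gap[of t "t + 2"] gap[of t "t + 3"] gap[of t "t + 4"]
      gap[of "t + 1" "t + 2"] gap[of "t + 1" "t + 3"] gap[of "t + 1" "t + 4"]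
      gap[of "t + 2" "t + 3"] gap[of "t + 2" "t + 4"] gap[of "t + 3" "t + 4"]
    by (auto simp: of_bool_def)
  have binom: "9 choose 0 = (1::nat)" "9 choose 1 = (9::nat)" "9 choose 2 = (36::nat)" "9 choose 3 = (84::nat)"
    "9 choose 4 = (126::nat)" "9 choose 5 = (126::nat)" "9 choose 6 = (84::nat)" "9 choose 7 = (36::nat)"
    "9 choose 8 = (9::nat)" "9 choose 9 = (1::nat)"
    by (simp_all add: numeral_eq_Suc)
  have set: "{..9} = {0,1,2,3,4,5,6,7,8,9::nat}" by auto
  have "(\<Sum>j\<le>9. of_bool (b j) * (9 choose j)) = of_bool (b 0) + 9 * of_bool (b 1) + 36 * of_bool (b 2)
     + 84 * of_bool (b 3) + 126 * of_bool (b 4) + 126 * of_bool (b 5) + 84 * of_bool (b 6)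
     + 36 * of_bool (b 7) + 9 * of_bool (b 8) + (of_bool (b 9)::nat)"
    unfolding set by (simp add: binom del: One_nat_def binomial_1 binomial_Suc_n)
  also have "\<dots> \<le> 128"
    using window[of 0] window[of 1] window[of 2] window[of 3] window[of 4] window[of 5] by simp
  finally show ?thesis .
qed

text \<open>The maximum is the central coefficient; the resulting density 6/16 = 3/8 is the
  threshold used for values in a group of order three.\<close>

lemma binomial_4_gap_3:
  fixes b :: "nat \<Rightarrow> bool"
  assumes gap: "\<And>j k. b j \<Longrightarrow> b k \<Longrightarrow> j < k \<Longrightarrow> j + 3 \<le> k"
  shows "(\<Sum>j\<le>4. of_bool (b j) * (4 choose j)) \<le> (6::nat)"
proof -
  have window: "of_bool (b t) + of_bool (b (t + 1)) + of_bool (b (t + 2)) \<le> (1::nat)" for t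
    using gap[of t "t + 1"] gap[of t "t + 2"] gap[of "t + 1" "t + 2"] by (auto simp: of_bool_def)
  have binom: "4 choose 0 = (1::nat)" "4 choose 1 = (4::nat)" "4 choose 2 = (6::nat)" "4 choose 3 = (4::nat)"
    "4 choose 4 = (1::nat)"
    by (simp_all add: numeral_eq_Suc)
  have set: "{..4} = {0,1,2,3,4::nat}" by auto
  have "(\<Sum>j\<le>4. of_bool (b j) * (4 choose j)) = of_bool (b 0) + 4 * of_bool (b 1) + 6 * of_bool (b 2)
     + 4 * of_bool (b 3) + (of_bool (b 4)::nat)"
    unfolding set by (simp add: binom del: One_nat_def binomial_1 binomial_Suc_n)
  also have "\<dots> \<le> 6" using window[of 0] window[of 1] window[of 2]
    by (auto simp: numeral_eq_Suc of_bool_def split: if_splits)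
  finally show ?thesis .
qed

context comm_group
begin

text \<open>The support splits into the coordinates of slope \<open>v\<close> and those of slope
  \<open>inv v\<close>. If either class had \<open>Suc m\<close> elements,
  \<open>affine_fibre_pow\<close> on these would cap the density at \<open>c / 2 ^ Suc m\<close>,
  against \<open>dense\<close>. Powers of \<open>inv v\<close> are trivial exactly when those of
  \<open>v\<close> are.\<close>

lemma support_card_le:
  assumes D: "D \<in> affine_on I" and "finite I" and v: "v \<in> carrier G"
    and slopes: "\<And>i. i \<in> I \<Longrightarrow> slope D i \<in> {\<one>, v, inv v}"
    and ord: "\<And>k. 1 \<le> k \<Longrightarrow> k < q \<Longrightarrow> v [^] k \<noteq> \<one>"
    and bound: "\<And>b. (\<And>j k. b j \<Longrightarrow> b k \<Longrightarrow> j < k \<Longrightarrow> j + q \<le> k) \<Longrightarrow>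
        (\<Sum>j\<le>Suc m. of_bool (b j) * (Suc m choose j)) \<le> c"
    and dense: "c * 2 ^ card I < 2 ^ Suc m * card {X. X \<subseteq> I \<and> D X = \<one>}"
  shows "card (support I D) \<le> 2 * m"
proof -
  have le: "card {i \<in> I. slope D i = w} \<le> m" if "w \<in> {v, inv v}" for w
  proof (rule ccontr)
    assume "\<not> card {i \<in> I. slope D i = w} \<le> m"
    then obtain T where T: "T \<subseteq> {i \<in> I. slope D i = w}" "card T = Suc m"
      using obtain_subset_with_card_n[of "Suc m" "{i \<in> I. slope D i = w}"] by auto
    have "w [^] k \<noteq> \<one>" if "1 \<le> k" "k < q" for k :: nat
      using ord[OF that] \<open>w \<in> {v, inv v}\<close> v by (auto simp: nat_pow_inv)
    then have "2 ^ Suc m * card {X. X \<subseteq> I \<and> D X = \<one>} \<le> c * 2 ^ card I"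
      using affine_fibre_pow[OF D \<open>finite I\<close>, of T w q c] T bound that v by auto
    then show False using dense by simp
  qed
  have "card (support I D) \<le> card ({i \<in> I. slope D i = v} \<union> {i \<in> I. slope D i = inv v})"
    using slopes \<open>finite I\<close> by (intro card_mono) (auto simp: support_def)
  also have "\<dots> \<le> m + m" using le[of v] le[of "inv v"] card_Un_le[of "{i \<in> I. slope D i = v}"] 
    by (meson add_mono insertCI order_trans)
  finally show ?thesis by simp
qed

end

section \<open>Sparse functions\<close>

text \<open>For a fixed value \<open>v\<close>, the number \<open>C v\<close> of members of
  \<open>L\<close> with value \<open>v\<close> has mean \<open>m v\<close>, at most half of
  \<open>card L\<close>, and small variance by pairwise independence. Since \<open>f\<close> picks
  its value afresh at each point, the variances are summed over all values; the sum stays small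
  because the probabilities of the values of one member add up to one.\<close>

lemma independent_plurality:
  fixes r :: "'p \<Rightarrow> 'w \<Rightarrow> 'b" and f :: "'w \<Rightarrow> 'b" and \<epsilon> :: real
  assumes fin: "finite \<Omega>" "\<Omega> \<noteq> {}" "finite L" "L \<noteq> {}" and "0 < \<epsilon>"
    and half: "\<And>P v. P \<in> L \<Longrightarrow> 2 * card {W \<in> \<Omega>. r P W = v} \<le> card \<Omega>"
    and indep: "\<And>P Q v. P \<in> L \<Longrightarrow> Q \<in> L \<Longrightarrow> P \<noteq> Q \<Longrightarrow>
      card {W \<in> \<Omega>. r P W = v \<and> r Q W = v} * card \<Omega>
        = card {W \<in> \<Omega>. r P W = v} * card {W \<in> \<Omega>. r Q W = v}"
  shows "(\<Sum>P\<in>L. real (card {W \<in> \<Omega>. f W = r P W}))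
    \<le> card \<Omega> * (card L / 2 + \<epsilon> * card L / 2 + 1 / (2 * \<epsilon>))"
proof -
  define N where "N = real (card L)"
  define M where "M = real (card \<Omega>)"
  define V where "V = (\<Union>P\<in>L. r P ` \<Omega>)"
  define p where "p P v = real (card {W \<in> \<Omega>. r P W = v})" for P v
  define C where "C v W = (\<Sum>P\<in>L. of_bool (r P W = v) :: real)" for v W
  define m where "m v = (\<Sum>P\<in>L. p P v) / M" for v
  \<comment> \<open>The scale of the deviation: the error terms \<open>K / 2\<close> and
    \<open>N / (2 * K)\<close> become \<open>\<epsilon> * N / 2\<close> and
    \<open>1 / (2 * \<epsilon>)\<close>.\<close>
  define K where "K = \<epsilon> * N"
  have N: "N > 0" and M: "M > 0" using fin by (auto simp: N_def M_def card_gt_0_iff)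
  then have K: "K > 0" using \<open>0 < \<epsilon>\<close> by (simp add: K_def)
  have fV: "finite V" using fin by (simp add: V_def)
  have sumC: "(\<Sum>W\<in>\<Omega>. C v W) = M * m v" for v
  proof -
    have "(\<Sum>W\<in>\<Omega>. C v W) = (\<Sum>P\<in>L. p P v)"
      unfolding C_def p_def card_eq_sum_of_bool[OF fin(1)] by (rule sum.swap)
    then show ?thesis using M by (simp add: m_def)
  qed
  have m_le: "m v \<le> N / 2" for v
  proof -
    have "(\<Sum>P\<in>L. p P v) \<le> (\<Sum>P\<in>L. M / 2)"
    proof (rule sum_mono)
      fix P assume "P \<in> L"
      then have "real (2 * card {W \<in> \<Omega>. r P W = v}) \<le> real (card \<Omega>)" using half by (simp only: of_nat_le_iff)
      then show "p P v \<le> M / 2" by (simp add: p_def M_def)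
    qed
    then show ?thesis using M by (simp add: m_def N_def field_simps)
  qed
  have sumC2: "(\<Sum>W\<in>\<Omega>. (C v W)\<^sup>2) \<le> M * (m v)\<^sup>2 + (\<Sum>P\<in>L. p P v)" for v
  proof -
    have "(\<Sum>W\<in>\<Omega>. (C v W)\<^sup>2) = (\<Sum>P\<in>L. \<Sum>Q\<in>L. real (card {W \<in> \<Omega>. r P W = v \<and> r Q W = v}))"
      unfolding sum_pairs_card[OF fin(3) fin(1)]
      by (simp add: C_def power2_eq_square sum_product of_bool_conj)
    \<comment> \<open>Off the diagonal independence gives the product term exactly; on the diagonal
      the full \<open>p P v\<close> is added.\<close>
    also have "\<dots> \<le> (\<Sum>P\<in>L. \<Sum>Q\<in>L. p P v * p Q v / M + (if Q = P then p P v else 0))"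
    proof (intro sum_mono)
      fix P Q assume PQ: "P \<in> L" "Q \<in> L"
      show "real (card {W \<in> \<Omega>. r P W = v \<and> r Q W = v}) \<le> p P v * p Q v / M + (if Q = P then p P v else 0)"
      proof (cases "P = Q")
        case True
        then show ?thesis using M by (simp add: p_def)
      next
        case False
        then have "real (card {W \<in> \<Omega>. r P W = v \<and> r Q W = v}) * M = p P v * p Q v"
          using indep[OF PQ False, of v] unfolding p_def M_def by (simp only: of_nat_mult[symmetric])
        then show ?thesis using M False by (simp add: field_simps)
      qed
    qed
    also have "\<dots> = (\<Sum>P\<in>L. p P v) * (\<Sum>Q\<in>L. p Q v) / M + (\<Sum>P\<in>L. p P v)"
      using fin by (simp add: sum.distrib sum_product sum_divide_distrib sum.delta)
    also have "(\<Sum>P\<in>L. p P v) * (\<Sum>Q\<in>L. p Q v) / M = M * (m v)\<^sup>2"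
      using M by (simp add: m_def power2_eq_square)
    finally show ?thesis .
  qed
  have "(\<Sum>W\<in>\<Omega>. \<Sum>v\<in>V. (C v W - m v)\<^sup>2) = (\<Sum>v\<in>V. \<Sum>W\<in>\<Omega>. (C v W - m v)\<^sup>2)"
    by (rule sum.swap)
  also have "\<dots> \<le> (\<Sum>v\<in>V. \<Sum>P\<in>L. p P v)"
  proof (rule sum_mono)
    fix v
    have "(\<Sum>W\<in>\<Omega>. (C v W - m v)\<^sup>2) = (\<Sum>W\<in>\<Omega>. (C v W)\<^sup>2) - 2 * m v * (\<Sum>W\<in>\<Omega>. C v W) + M * (m v)\<^sup>2"
      by (simp add: power2_diff sum.distrib sum_subtractf sum_distrib_left M_def algebra_simps)
    then show "(\<Sum>W\<in>\<Omega>. (C v W - m v)\<^sup>2) \<le> (\<Sum>P\<in>L. p P v)"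
      using sumC2[of v] sumC[of v] by (simp add: power2_eq_square algebra_simps)
  qed
  also have "\<dots> = (\<Sum>P\<in>L. \<Sum>v\<in>V. p P v)" by (rule sum.swap)
  also have "\<dots> = (\<Sum>P\<in>L. M)"
  proof (rule sum.cong[OF refl])
    fix P assume P: "P \<in> L"
    have "(\<Sum>v\<in>V. p P v) = (\<Sum>W\<in>\<Omega>. \<Sum>v\<in>V. of_bool (r P W = v))"
      unfolding p_def card_eq_sum_of_bool[OF fin(1)] by (rule sum.swap)
    also have "\<dots> = (\<Sum>W\<in>\<Omega>. 1)"
      using fV P by (intro sum.cong refl) (auto simp: of_bool_def V_def sum.delta)
    finally show "(\<Sum>v\<in>V. p P v) = M" by (simp add: M_def)
  qed
  finally have var: "(\<Sum>W\<in>\<Omega>. \<Sum>v\<in>V. (C v W - m v)\<^sup>2) \<le> N * M" by (simp add: N_def)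
  have pt: "C (f W) W \<le> N / 2 + K / 2 + (\<Sum>v\<in>V. (C v W - m v)\<^sup>2) / (2 * K)" if W: "W \<in> \<Omega>" for W
  proof (cases "f W \<in> V")
    case True
    \<comment> \<open>This square turns the deviation at the chosen value into its square, which the
      sum over all of \<open>V\<close> dominates whatever \<open>f W\<close> is.\<close>
    have "0 \<le> (C (f W) W - m (f W) - K)\<^sup>2" by simp
    then have "2 * K * (C (f W) W - m (f W)) \<le> (C (f W) W - m (f W))\<^sup>2 + K\<^sup>2"
      by (simp add: power2_eq_square algebra_simps)
    also have "\<dots> \<le> (\<Sum>v\<in>V. (C v W - m v)\<^sup>2) + K\<^sup>2"
      using member_le_sum[of "f W" V "\<lambda>v. (C v W - m v)\<^sup>2"] True fV by simp
    finally have "C (f W) W - m (f W) \<le> (\<Sum>v\<in>V. (C v W - m v)\<^sup>2) / (2 * K) + K / 2"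
      using K by (simp add: field_simps power2_eq_square)
    then show ?thesis using m_le[of "f W"] by simp
  next
    case False
    then have "r P W \<noteq> f W" if "P \<in> L" for P using that W by (force simp: V_def)
    then have "C (f W) W = 0" by (simp add: C_def)
    moreover have "0 \<le> (\<Sum>v\<in>V. (C v W - m v)\<^sup>2) / (2 * K)" using K by (simp add: sum_nonneg)
    ultimately show ?thesis using N K by linarith
  qed
  have "(\<Sum>P\<in>L. real (card {W \<in> \<Omega>. f W = r P W})) = (\<Sum>W\<in>\<Omega>. C (f W) W)"
    unfolding C_def card_eq_sum_of_bool[OF fin(1)] by (subst sum.swap) (auto intro!: sum.cong)
  also have "\<dots> \<le> (\<Sum>W\<in>\<Omega>. N / 2 + K / 2 + (\<Sum>v\<in>V. (C v W - m v)\<^sup>2) / (2 * K))"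
    by (intro sum_mono pt)
  also have "\<dots> = M * (N / 2 + K / 2) + (\<Sum>W\<in>\<Omega>. \<Sum>v\<in>V. (C v W - m v)\<^sup>2) / (2 * K)"
    by (simp add: sum.distrib sum_divide_distrib M_def)
  also have "\<dots> \<le> M * (N / 2 + K / 2) + N * M / (2 * K)"
    using var K by (intro add_left_mono divide_right_mono) auto
  also have "\<dots> = M * (N / 2 + \<epsilon> * N / 2 + 1 / (2 * \<epsilon>))"
    using N \<open>0 < \<epsilon>\<close> by (simp add: K_def field_simps)
  finally show ?thesis by (simp add: N_def M_def)
qed

section \<open>Lists of functions with small support\<close>

definition close_on :: "'i set \<Rightarrow> real \<Rightarrow> ('i set \<Rightarrow> 'b) \<Rightarrow> ('i set \<Rightarrow> 'b) \<Rightarrow> bool" where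
  "close_on I \<epsilon> f P \<longleftrightarrow> (1/2 + \<epsilon>) * 2 ^ card I \<le> real (card {X. X \<subseteq> I \<and> f X = P X})"

text \<open>Here \<open>k\<close> bounds the supports, \<open>r\<close> is the number of coordinates
  that a support may have beyond a common core, and \<open>x\<close> stands for
  \<open>1 / \<epsilon>\<close>. The first summand pays for supports equal to the core, the second
  for branching over at most \<open>k * x^2\<close> coordinates that enlarge the core.\<close>

primrec sparse_bound :: "nat \<Rightarrow> nat \<Rightarrow> real \<Rightarrow> real" where
  "sparse_bound k 0 x = 2 ^ (2 ^ k) * x"
| "sparse_bound k (Suc r) x = 2 ^ (2 ^ k) * x + real k * x\<^sup>2 * sparse_bound k r x"

lemma sparse_bound_nonneg: "0 \<le> x \<Longrightarrow> 0 \<le> sparse_bound k r x"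
  by (induction r) auto

context comm_group
begin

lemma affine_eq_of_agree:
  assumes "P \<in> affine_on I" "Q \<in> affine_on I" "finite I"
    and "2 ^ card I < 2 * card {X. X \<subseteq> I \<and> P X = Q X}"
  shows "P = Q"
proof (rule affine_eqI[OF assms(1,2)], rule ccontr)
  fix X assume X: "X \<subseteq> I" "P X \<noteq> Q X"
  have "{X. X \<subseteq> I \<and> affine_div I P Q X = \<one>} = {X. X \<subseteq> I \<and> P X = Q X}"
    using affine_div_eq_one_iff[OF assms(1,2)] by blast
  then show False
    using affine_half[OF affine_div_affine[OF assms(1,2)] assms(3)] X assms(4)
      affine_div_eq_one_iff[OF assms(1,2)] by (metis linorder_not_less)
qed

text \<open>On every fibre over \<open>I - S\<close> a member \<open>P\<close> shows the same table
  \<open>U \<mapsto> P U\<close>. By averaging, it wins a strict majority against \<open>f\<close>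
  on at least a fraction \<open>2 * \<epsilon>\<close> of the fibres. On one fibre the majority
  winners are told apart by their agreement sets, which are subsets of \<open>Pow S\<close>.
  Counting pairs of a member and a fibre gives the bound.\<close>

lemma list_common_support:
  fixes \<epsilon> :: real
  assumes "finite I" "S \<subseteq> I" "0 < \<epsilon>" "finite L" "L \<subseteq> affine_on I"
    and supp: "\<And>P. P \<in> L \<Longrightarrow> support I P \<subseteq> S" and close: "\<And>P. P \<in> L \<Longrightarrow> close_on I \<epsilon> f P"
  shows "\<epsilon> * card L \<le> 2 ^ (2 ^ card S)"
proof -
  define B where "B P Y = {U. U \<subseteq> S \<and> f (Y \<union> U) = P U}" for P Y
  define H where "H P Y \<longleftrightarrow> 2 ^ card S < 2 * card (B P Y)" for P Y
  define s where "s = (2::real) ^ card S"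
  define t where "t = (2::real) ^ card (I - S)"
  have fS: "finite S" "finite (I - S)" using assms finite_subset by auto
  have st: "2 ^ card I = s * t" unfolding s_def t_def using assms(1,2) by (rule two_power_card_split)
  have pos: "s > 0" "t > 0" by (auto simp: s_def t_def)
  have fB: "finite (B P Y)" "card (B P Y) \<le> 2 ^ card S" for P Y
    using fS card_mono[of "Pow S" "B P Y"] by (auto simp: B_def card_Pow intro: finite_subset[of _ "Pow S"])
  have many: "2 * \<epsilon> * t \<le> (\<Sum>Y\<in>Pow (I - S). of_bool (H P Y))" if P: "P \<in> L" for P
  proof -
    have dep: "P (Y \<union> U) = P U" if "Y \<subseteq> I - S" "U \<subseteq> S" for Y U
    proof -
      have "(Y \<union> U) \<inter> S = U" "Y \<union> U \<subseteq> I" "P \<in> affine_on I" using that assms P by blast+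
      then show ?thesis
        using affine_depends_on_support[of P I S "Y \<union> U"] assms(1) supp[OF P] by simp
    qed
    have "(1/2 + \<epsilon>) * (s * t) \<le> real (card {X. X \<subseteq> I \<and> f X = P X})"
      using close[OF P] by (simp add: close_on_def st)
    also have "\<dots> = (\<Sum>Y\<in>Pow (I - S). real (card (B P Y)))"
      unfolding card_subsets_fibre[OF assms(1,2)] B_def using dep by (auto intro!: sum.cong arg_cong[of _ _ card])
    \<comment> \<open>A fibre without a majority contributes at most half of its points.\<close>
    also have "\<dots> \<le> (\<Sum>Y\<in>Pow (I - S). s / 2 + s / 2 * of_bool (H P Y))"
    proof (rule sum_mono)
      fix Y
      have "real (card (B P Y)) \<le> s" using fB(2)[of P Y] unfolding s_def by (metis of_nat_le_iff of_nat_numeral of_nat_power)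
      moreover have "2 * real (card (B P Y)) \<le> s" if "\<not> H P Y"
      proof -
        have "2 * card (B P Y) \<le> 2 ^ card S" using that by (simp add: H_def)
        then have "real (2 * card (B P Y)) \<le> real (2 ^ card S)" by (simp only: of_nat_le_iff)
        then show ?thesis by (simp add: s_def)
      qed
      ultimately show "real (card (B P Y)) \<le> s / 2 + s / 2 * of_bool (H P Y)" by (cases "H P Y") auto
    qed
    also have "\<dots> = t * s / 2 + s / 2 * (\<Sum>Y\<in>Pow (I - S). of_bool (H P Y))"
      unfolding sum.distrib sum_distrib_left[symmetric] using fS by (simp add: card_Pow t_def)
    finally have "s * (2 * \<epsilon> * t) \<le> s * (\<Sum>Y\<in>Pow (I - S). of_bool (H P Y))" by (simp add: algebra_simps)
    then show ?thesis using pos by simp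
  qed
  have few: "(\<Sum>P\<in>L. of_bool (H P Y)) \<le> (2 ^ (2 ^ card S) :: real)" for Y
  proof -
    \<comment> \<open>Two winners with the same agreement set both equal \<open>f\<close> there,
      hence agree with each other on more than half of the tables, so on more than half of the
      cube.\<close>
    have "inj_on (\<lambda>P. B P Y) {P \<in> L. H P Y}"
    proof (rule inj_onI)
      fix P Q assume PQ: "P \<in> {P \<in> L. H P Y}" "Q \<in> {P \<in> L. H P Y}" "B P Y = B Q Y"
      have mem: "P \<in> affine_on I" "Q \<in> affine_on I" using PQ assms(5) by auto
      have "B P Y \<subseteq> {U. U \<subseteq> S \<and> P U = Q U}" 
      proof
        fix U assume "U \<in> B P Y"
        moreover from this have "U \<in> B Q Y" using PQ(3) by simp
        ultimately show "U \<in> {U. U \<subseteq> S \<and> P U = Q U}" by (simp add: B_def)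
      qed
      then have "card (B P Y) \<le> card {U. U \<subseteq> S \<and> P U = Q U}" using fS by (intro card_mono) auto
      then have big: "2 ^ card S < 2 * card {U. U \<subseteq> S \<and> P U = Q U}" using PQ(1) by (simp add: H_def)
      have "P W = P (W \<inter> S)" "Q W = Q (W \<inter> S)" if "W \<subseteq> I" for W
        using affine_depends_on_support[OF mem(1) assms(1) _ that] affine_depends_on_support[OF mem(2) assms(1) _ that]
          supp PQ by auto
      then have "card {X. X \<subseteq> I \<and> P X = Q X} = card {U. U \<subseteq> S \<and> P U = Q U} * 2 ^ card (I - S)"
        by (intro card_subsets_depends[OF assms(1,2), where g = "\<lambda>X. P X = Q X"]) metis
      then have "2 ^ card I < 2 * card {X. X \<subseteq> I \<and> P X = Q X}"
        using big by (simp add: two_power_card_split[OF assms(1,2)])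
      then show "P = Q" using affine_eq_of_agree mem assms(1) by blast
    qed
    moreover have "(\<lambda>P. B P Y) ` {P \<in> L. H P Y} \<subseteq> Pow (Pow S)" by (auto simp: B_def)
    ultimately have "card {P \<in> L. H P Y} \<le> card (Pow (Pow S))"
      using fS by (intro card_inj_on_le) auto
    also have "\<dots> = 2 ^ (2 ^ card S)" using fS by (simp add: card_Pow)
    finally have "real (card {P \<in> L. H P Y}) \<le> real (2 ^ (2 ^ card S))" by (simp only: of_nat_le_iff)
    then show ?thesis by (simp only: card_eq_sum_of_bool[OF assms(4)]) simp
  qed
  have "card L * (2 * \<epsilon> * t) \<le> (\<Sum>P\<in>L. \<Sum>Y\<in>Pow (I - S). of_bool (H P Y))"
    using sum_bounded_below[of L "2 * \<epsilon> * t" "\<lambda>P. \<Sum>Y\<in>Pow (I - S). of_bool (H P Y)"] many by simp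
  also have "\<dots> = (\<Sum>Y\<in>Pow (I - S). \<Sum>P\<in>L. of_bool (H P Y))" by (rule sum.swap)
  also have "\<dots> \<le> t * 2 ^ (2 ^ card S)"
    using sum_bounded_above[of "Pow (I - S)" "\<lambda>Y. \<Sum>P\<in>L. of_bool (H P Y)" "2 ^ (2 ^ card S) :: real"] few fS
    by (simp add: card_Pow t_def)
  finally have "t * (2 * (\<epsilon> * card L)) \<le> t * 2 ^ (2 ^ card S)" by (simp add: algebra_simps)
  then have "2 * (\<epsilon> * card L) \<le> 2 ^ (2 ^ card S)" using pos by simp
  moreover have "0 \<le> \<epsilon> * card L" using \<open>0 < \<epsilon>\<close> by simp
  ultimately show ?thesis by linarith
qed

text \<open>Freeze the coordinates of the core \<open>Y\<close>. What remains of the members depends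
  on disjoint nonempty sets of coordinates, so \<open>independent_plurality\<close> applies on each
  fibre. Summed over the fibres it reads \<open>N * (1/2 + \<epsilon>) \<le> N / 2 + \<epsilon> * N
  / 2 + 1 / (2 * \<epsilon>)\<close>.\<close>

lemma list_sunflower:
  fixes \<epsilon> :: real
  assumes "finite I" "Y \<subseteq> I" "0 < \<epsilon>" "finite L" "L \<subseteq> affine_on I"
    and ne: "\<And>P. P \<in> L \<Longrightarrow> support I P - Y \<noteq> {}"
    and disj: "\<And>P Q. P \<in> L \<Longrightarrow> Q \<in> L \<Longrightarrow> P \<noteq> Q \<Longrightarrow> support I P \<inter> support I Q \<subseteq> Y"
    and close: "\<And>P. P \<in> L \<Longrightarrow> close_on I \<epsilon> f P"
  shows "\<epsilon>\<^sup>2 * card L \<le> 1"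
proof (cases "L = {}")
  case False
  define A where "A = I - Y"
  define N where "N = real (card L)"
  have fA: "finite A" "A \<subseteq> I" "I - A = Y" using assms by (auto simp: A_def)
  have N: "N > 0" using False assms by (simp add: N_def card_gt_0_iff)
  have aff: "P \<in> affine_on I" if "P \<in> L" for P using that assms by auto
  have one: "(\<Sum>P\<in>L. real (card {W \<in> Pow A. f (B \<union> W) = P (B \<union> W)}))
      \<le> card (Pow A) * (card L / 2 + \<epsilon> * card L / 2 + 1 / (2 * \<epsilon>))" if B: "B \<subseteq> Y" for B
  proof (rule independent_plurality)
    fix P v assume P: "P \<in> L"
    obtain i where "i \<in> A" "slope P i \<noteq> \<one>" using ne[OF P] by (auto simp: support_def A_def)
    then have "2 * card {W. W \<subseteq> A \<and> P (B \<union> W) = v} \<le> 2 ^ card A"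
      using B assms by (intro affine_value_half[OF aff[OF P] assms(1), of A B i]) (auto simp: A_def)
    then show "2 * card {W \<in> Pow A. P (B \<union> W) = v} \<le> card (Pow A)" using fA by (simp add: card_Pow)
  next
    fix P Q v assume PQ: "P \<in> L" "Q \<in> L" "P \<noteq> Q"
    define Z where "Z = support I P - Y"
    have Z: "Z \<subseteq> A" by (auto simp: Z_def A_def support_def)
    have BW: "B \<union> W \<subseteq> I" if "W \<subseteq> A" for W using that B assms by (auto simp: A_def)
    have "P (B \<union> W) = P (B \<union> (W \<inter> Z))" if "W \<subseteq> A" for W
    proof -
      have eq: "(B \<union> W) \<inter> (support I P \<union> B) = (B \<union> (W \<inter> Z)) \<inter> (support I P \<union> B)"
        using that by (auto simp: Z_def A_def)
      have "P (B \<union> W) = P ((B \<union> W) \<inter> (support I P \<union> B))"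
        using BW that by (intro affine_depends_on_support[OF aff[OF PQ(1)] assms(1)]) auto
      also have "\<dots> = P (B \<union> (W \<inter> Z))" unfolding eq
        using BW[of "W \<inter> Z"] that by (intro affine_depends_on_support[OF aff[OF PQ(1)] assms(1), symmetric]) auto
      finally show ?thesis .
    qed
    moreover have "Q (B \<union> W) = Q (B \<union> (W - Z))" if "W \<subseteq> A" for W
    proof -
      have eq: "(B \<union> W) \<inter> (support I Q \<union> B) = (B \<union> (W - Z)) \<inter> (support I Q \<union> B)"
        using that disj[OF PQ] by (auto simp: Z_def A_def)
      have "Q (B \<union> W) = Q ((B \<union> W) \<inter> (support I Q \<union> B))"
        using BW that by (intro affine_depends_on_support[OF aff[OF PQ(2)] assms(1)]) auto
      also have "\<dots> = Q (B \<union> (W - Z))" unfolding eq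
        using BW[of "W - Z"] that by (intro affine_depends_on_support[OF aff[OF PQ(2)] assms(1), symmetric]) auto
      finally show ?thesis .
    qed
    ultimately have "card {W. W \<subseteq> A \<and> P (B \<union> W) = v \<and> Q (B \<union> W) = v} * 2 ^ card A
        = card {W. W \<subseteq> A \<and> P (B \<union> W) = v} * card {W. W \<subseteq> A \<and> Q (B \<union> W) = v}"
      by (intro card_subsets_independent[OF fA(1) Z]) metis+
    then show "card {W \<in> Pow A. P (B \<union> W) = v \<and> Q (B \<union> W) = v} * card (Pow A)
        = card {W \<in> Pow A. P (B \<union> W) = v} * card {W \<in> Pow A. Q (B \<union> W) = v}"
      using fA by (simp add: card_Pow)
  qed (use fA False assms in auto)
  define M where "M = (2::real) ^ card I"
  have "N * ((1/2 + \<epsilon>) * M) \<le> (\<Sum>P\<in>L. real (card {X. X \<subseteq> I \<and> f X = P X}))"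
    using sum_bounded_below[of L "(1/2 + \<epsilon>) * M" "\<lambda>P. real (card {X. X \<subseteq> I \<and> f X = P X})"] close
    by (simp add: N_def M_def close_on_def)
  also have "\<dots> = (\<Sum>P\<in>L. \<Sum>B\<in>Pow Y. real (card {W \<in> Pow A. f (B \<union> W) = P (B \<union> W)}))"
    unfolding card_subsets_fibre[OF assms(1) fA(2)] fA(3) by simp
  also have "\<dots> = (\<Sum>B\<in>Pow Y. \<Sum>P\<in>L. real (card {W \<in> Pow A. f (B \<union> W) = P (B \<union> W)}))"
    by (rule sum.swap)
  also have "\<dots> \<le> (\<Sum>B\<in>Pow Y. 2 ^ card A * (N / 2 + \<epsilon> * N / 2 + 1 / (2 * \<epsilon>)))"
    using one fA by (intro sum_mono) (simp add: card_Pow N_def)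
  also have "\<dots> = M * (N / 2 + \<epsilon> * N / 2 + 1 / (2 * \<epsilon>))"
    using finite_subset[OF assms(2,1)]
    by (simp add: card_Pow M_def two_power_card_split[OF assms(1,2)] A_def)
  finally have "M * (N * (1/2 + \<epsilon>)) \<le> M * (N / 2 + \<epsilon> * N / 2 + 1 / (2 * \<epsilon>))"
    by (simp add: algebra_simps)
  then have "N * (1/2 + \<epsilon>) \<le> N / 2 + \<epsilon> * N / 2 + 1 / (2 * \<epsilon>)" by (simp add: M_def)
  then have "\<epsilon> * N \<le> 1 / \<epsilon>" using \<open>0 < \<epsilon>\<close> by (simp add: field_simps)
  then show ?thesis using \<open>0 < \<epsilon>\<close> by (simp add: N_def field_simps power2_eq_square)
qed simp

text \<open>Induction on the room \<open>r\<close> left beyond the core \<open>Y\<close>. Supports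
  equal to \<open>Y\<close> fall to \<open>list_common_support\<close>. Among the others, a maximal
  family whose supports meet pairwise only in \<open>Y\<close> is small by
  \<open>list_sunflower\<close>; the union of its petals hits every remaining support outside
  \<open>Y\<close>, and each hitting coordinate is added to the core.\<close>

lemma list_sparse_core:
  fixes \<epsilon> :: real
  assumes "finite I" "0 < \<epsilon>" "finite L" "L \<subseteq> affine_on I"
    and "\<And>P. P \<in> L \<Longrightarrow> Y \<subseteq> support I P" "\<And>P. P \<in> L \<Longrightarrow> card (support I P) \<le> k" "card Y + r = k"
    and "\<And>P. P \<in> L \<Longrightarrow> close_on I \<epsilon> f P"
  shows "real (card L) \<le> sparse_bound k r (1 / \<epsilon>)"
  using assms(3-)
proof (induction r arbitrary: L Y)
  case (0 L Y)
  show ?case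
  proof (cases "L = {}")
    case False
    then obtain P0 where P0: "P0 \<in> L" by blast
    have fs: "finite (support I P)" for P using assms(1,2) by (simp add: support_def)
    have eq: "support I P = Y" if "P \<in> L" for P
      using card_seteq[OF fs, of Y P] 0 that by auto
    have "Y \<subseteq> I" using eq[OF P0] by (auto simp: support_def)
    then have "\<epsilon> * card L \<le> 2 ^ (2 ^ card Y)"
      using list_common_support[of I Y \<epsilon> L f] assms(1,2) 0(1,2,6) eq by simp
    then show ?thesis using 0 \<open>0 < \<epsilon>\<close> by (simp add: field_simps)
  qed (use assms(1,2) in simp)
next
  case (Suc r L Y)
  define b where "b = sparse_bound k r (1 / \<epsilon>)"
  have b: "b \<ge> 0" using assms(1,2) by (simp add: b_def sparse_bound_nonneg)
  define L0 where "L0 = {P \<in> L. support I P = Y}"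
  define L1 where "L1 = {P \<in> L. support I P \<noteq> Y}"
  have fin: "finite L0" "finite L1" using Suc by (auto simp: L0_def L1_def)
  have fs: "finite (support I P)" for P using assms(1,2) by (simp add: support_def)
  have L0: "real (card L0) \<le> 2 ^ (2 ^ k) * (1 / \<epsilon>)"
  proof (cases "L0 = {}")
    case False
    then have "Y \<subseteq> I" by (auto simp: L0_def support_def)
    then have "\<epsilon> * card L0 \<le> 2 ^ (2 ^ card Y)"
      using list_common_support[of I Y \<epsilon> L0 f] assms(1,2) fin(1) Suc.prems(2,6) by (auto simp: L0_def)
    also have "\<dots> \<le> 2 ^ (2 ^ k)" using Suc.prems(5) by (intro power_increasing) auto
    finally show ?thesis using \<open>0 < \<epsilon>\<close> by (simp add: field_simps)
  qed (use assms(1,2) in simp)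
  define disjoint_off where "disjoint_off M \<longleftrightarrow> M \<subseteq> L1 \<and>
    (\<forall>P\<in>M. \<forall>Q\<in>M. P \<noteq> Q \<longrightarrow> support I P \<inter> support I Q \<subseteq> Y)" for M
  have "finite {M. disjoint_off M}" "{M. disjoint_off M} \<noteq> {}"
    using fin by (auto simp: disjoint_off_def intro: finite_subset[of _ "Pow L1"])
  then obtain M where M: "disjoint_off M" and max: "\<And>M'. disjoint_off M' \<Longrightarrow> M \<subseteq> M' \<Longrightarrow> M = M'"
    using finite_has_maximal[of "{M. disjoint_off M}"] by auto
  have fM: "finite M" using M fin finite_subset by (auto simp: disjoint_off_def)
  have YI: "Y \<subseteq> I" if "M \<noteq> {}"
    using that M Suc.prems(3) by (fastforce simp: disjoint_off_def L1_def support_def)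
  have memM: "P \<in> L" "support I P - Y \<noteq> {}" if "P \<in> M" for P
    using that M Suc.prems(3)[of P] by (auto simp: disjoint_off_def L1_def)
  have cM: "real (card M) \<le> (1 / \<epsilon>)\<^sup>2"
  proof (cases "M = {}")
    case False
    have "\<epsilon>\<^sup>2 * card M \<le> 1"
      using list_sunflower[OF assms(1) YI[OF False] assms(2) fM, of f] memM M Suc.prems
      by (auto simp: disjoint_off_def)
    then show ?thesis using \<open>0 < \<epsilon>\<close> by (simp add: field_simps)
  qed simp
  define U where "U = (\<Union>P\<in>M. support I P - Y)"
  have fU: "finite U" using fM fs by (simp add: U_def)
  have "card U \<le> (\<Sum>P\<in>M. card (support I P - Y))" unfolding U_def using fM by (rule card_UN_le)
  also have "\<dots> \<le> (\<Sum>P\<in>M. k)"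
  proof (rule sum_mono)
    fix P assume "P \<in> M"
    then have "card (support I P) \<le> k" using memM Suc.prems by blast
    then show "card (support I P - Y) \<le> k" using card_mono[OF fs, of "support I P - Y" P] by auto
  qed
  finally have "real (card U) \<le> real k * real (card M)"
    by (metis mult.commute of_nat_le_iff of_nat_mult sum_constant of_nat_id)
  also have "\<dots> \<le> real k * (1 / \<epsilon>)\<^sup>2" using cM by (rule mult_left_mono) simp
  finally have cU: "real (card U) \<le> real k * (1 / \<epsilon>)\<^sup>2" .
  \<comment> \<open>A support avoiding all petals could be added to \<open>M\<close>, against
    maximality.\<close>
  have hit: "\<exists>u\<in>U. u \<in> support I P" if P: "P \<in> L1" for P
  proof (rule ccontr)
    assume no: "\<not> (\<exists>u\<in>U. u \<in> support I P)"
    have "disjoint_off (insert P M)"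
      using M P no by (auto simp: disjoint_off_def U_def)
    then have "P \<in> M" using max[of "insert P M"] by auto
    then show False using memM(2) no by (auto simp: U_def)
  qed
  have each: "real (card {P \<in> L1. u \<in> support I P}) \<le> b" if u: "u \<in> U" for u
    unfolding b_def
  \<comment> \<open>Petals lie outside \<open>Y\<close>, so the core grows by exactly one while
    \<open>r\<close> drops by one.\<close>
  proof (rule Suc.IH[of _ "insert u Y"])
    have "Y \<subseteq> I" using YI u by (auto simp: U_def)
    then have "finite Y" "u \<notin> Y" using assms(1,2) u finite_subset by (auto simp: U_def)
    then show "card (insert u Y) + r = k" using Suc.prems by simp
  qed (use Suc.prems in \<open>auto simp: L1_def\<close>)
  have "L1 \<subseteq> (\<Union>u\<in>U. {P \<in> L1. u \<in> support I P})" using hit by blast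
  then have "card L1 \<le> card (\<Union>u\<in>U. {P \<in> L1. u \<in> support I P})"
    using fin fU by (intro card_mono) auto
  also have "\<dots> \<le> (\<Sum>u\<in>U. card {P \<in> L1. u \<in> support I P})" using fU by (rule card_UN_le)
  finally have "real (card L1) \<le> (\<Sum>u\<in>U. real (card {P \<in> L1. u \<in> support I P}))"
    by (simp only: of_nat_sum[symmetric] of_nat_le_iff)
  also have "\<dots> \<le> real (card U) * b" using each by (rule sum_bounded_above)
  also have "\<dots> \<le> real k * (1 / \<epsilon>)\<^sup>2 * b" using cU b by (rule mult_right_mono)
  finally have L1: "real (card L1) \<le> real k * (1 / \<epsilon>)\<^sup>2 * b" .
  have "L = L0 \<union> L1" by (auto simp: L0_def L1_def)
  then have "card L \<le> card L0 + card L1" by (metis card_Un_le)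
  then show ?case using L0 L1 by (simp add: b_def)
qed

lemma list_sparse:
  fixes \<epsilon> :: real
  assumes "finite I" "0 < \<epsilon>" "finite L" "L \<subseteq> affine_on I"
    and "\<And>P. P \<in> L \<Longrightarrow> card (support I P) \<le> k" "\<And>P. P \<in> L \<Longrightarrow> close_on I \<epsilon> f P"
  shows "real (card L) \<le> sparse_bound k k (1 / \<epsilon>)"
  using list_sparse_core[of I \<epsilon> L "{}" k k f] assms by simp

end

section \<open>Groups of small exponent\<close>

text \<open>The value \<open>z\<close> is taken \<open>n\<close> times and the remaining members
  share at most \<open>q\<close> further values; Cauchy-Schwarz on these bounds the number of
  agreeing pairs from below.\<close>

lemma pair_count_lower:
  fixes g :: "'p \<Rightarrow> 'b" and n :: real
  assumes "finite L" "finite H" "\<And>P. P \<in> L \<Longrightarrow> g P \<in> H" "z \<in> H" "card H \<le> Suc q"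
  defines "n \<equiv> (\<Sum>P\<in>L. of_bool (g P = z) :: real)"
  shows "q * n\<^sup>2 + (card L - n)\<^sup>2 \<le> real q * (\<Sum>P\<in>L. \<Sum>Q\<in>L. of_bool (g P = g Q))"
proof -
  define c where "c y = (\<Sum>P\<in>L. of_bool (g P = y) :: real)" for y
  have sel: "(\<Sum>y\<in>H. of_bool (g P = y) * h y) = h (g P)" if "P \<in> L" for P and h :: "'b \<Rightarrow> real"
    using assms(2) assms(3)[OF that] by (simp add: of_bool_def if_distrib[of "\<lambda>t. t * _"] sum.delta cong: if_cong)
  have tot: "(\<Sum>y\<in>H. c y) = card L"
    unfolding c_def by (subst sum.swap) (use sel[of _ "\<lambda>_. 1"] in simp)
  have "(\<Sum>P\<in>L. \<Sum>Q\<in>L. of_bool (g P = g Q)) = (\<Sum>P\<in>L. c (g P))"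
    unfolding c_def by (intro sum.cong refl) (auto simp: of_bool_def intro!: sum.cong)
  also have "\<dots> = (\<Sum>P\<in>L. \<Sum>y\<in>H. of_bool (g P = y) * c y)" using sel by simp
  also have "\<dots> = (\<Sum>y\<in>H. c y * c y)"
    by (subst sum.swap) (simp only: c_def sum_distrib_right)
  finally have K: "(\<Sum>P\<in>L. \<Sum>Q\<in>L. of_bool (g P = g Q)) = (\<Sum>y\<in>H. (c y)\<^sup>2)" by (simp add: power2_eq_square)
  have n: "n = c z" by (simp add: n_def c_def)
  have "(\<Sum>y\<in>H - {z}. c y) = card L - n" using tot assms(2,4) by (simp add: sum_diff1 n)
  then have "(card L - n)\<^sup>2 \<le> (\<Sum>y\<in>H - {z}. (c y)\<^sup>2) * card (H - {z})"
    using sum_squared_le_sum_of_squares[of c "H - {z}"] by simp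
  also have "\<dots> \<le> (\<Sum>y\<in>H - {z}. (c y)\<^sup>2) * q"
    using assms(2,4,5) by (intro mult_left_mono) (auto simp: sum_nonneg)
  also have "(\<Sum>y\<in>H - {z}. (c y)\<^sup>2) = (\<Sum>y\<in>H. (c y)\<^sup>2) - n\<^sup>2"
    using assms(2,4) by (simp add: sum_diff1 n)
  finally show ?thesis unfolding K by (simp add: algebra_simps)
qed

text \<open>\<open>pair_count_lower\<close> is applied at each point with the value of
  \<open>f\<close> as \<open>z\<close>, and summed. The function \<open>q * n^2 + (N - n)^2\<close>
  is convex in \<open>n\<close>, so it may be evaluated at
  \<open>m = (1/2 + \<epsilon>) * N\<close>, a lower bound for the mean.\<close>

lemma list_pair_agreement_lower:
  fixes f :: "'i set \<Rightarrow> 'b" and \<epsilon> :: real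
  assumes "finite I" "0 < \<epsilon>" "finite L" "finite H" "H \<noteq> {}" "card H \<le> Suc q" "1 \<le> q"
    and val: "\<And>P X. P \<in> L \<Longrightarrow> X \<subseteq> I \<Longrightarrow> P X \<in> H"
    and close: "\<And>P. P \<in> L \<Longrightarrow> close_on I \<epsilon> f P"
  shows "2 ^ card I * ((card L)\<^sup>2 * (q * (1/2 + \<epsilon>)\<^sup>2 + (1/2 - \<epsilon>)\<^sup>2))
    \<le> q * (\<Sum>P\<in>L. \<Sum>Q\<in>L. real (card {X. X \<subseteq> I \<and> P X = Q X}))"
proof -
  define N where "N = real (card L)"
  define M where "M = (2::real) ^ card I"
  define h where "h = (SOME h. h \<in> H)"
  \<comment> \<open>Values of \<open>f\<close> outside \<open>H\<close> match no member, so moving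
    them to an arbitrary \<open>h\<close> in \<open>H\<close> loses no agreement.\<close>
  define f' where "f' X = (if f X \<in> H then f X else h)" for X
  have f': "f' X \<in> H" for X using assms(5) by (simp add: f'_def h_def some_in_eq)
  define n where "n X = (\<Sum>P\<in>L. of_bool (P X = f' X) :: real)" for X
  define m where "m = (1/2 + \<epsilon>) * N"
  have cM: "real (card (Pow I)) = M" using assms(1) by (simp add: card_Pow M_def)
  have "M * m \<le> (\<Sum>P\<in>L. real (card {X \<in> Pow I. P X = f' X}))"
  proof -
    have "(1/2 + \<epsilon>) * M \<le> real (card {X \<in> Pow I. P X = f' X})" if P: "P \<in> L" for P
    proof -
      have "{X. X \<subseteq> I \<and> f X = P X} \<subseteq> {X \<in> Pow I. P X = f' X}"
        using val[OF P] by (auto simp: f'_def)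
      then have "card {X. X \<subseteq> I \<and> f X = P X} \<le> card {X \<in> Pow I. P X = f' X}"
        using assms(1) by (intro card_mono) auto
      then show ?thesis using close[OF P] by (simp add: close_on_def M_def)
    qed
    then show ?thesis
      using sum_bounded_below[of L "(1/2 + \<epsilon>) * M" "\<lambda>P. real (card {X \<in> Pow I. P X = f' X})"]
      by (simp add: m_def N_def mult_ac)
  qed
  also have "\<dots> = (\<Sum>X\<in>Pow I. n X)"
    unfolding n_def using assms(1) by (subst sum.swap) (simp only: card_eq_sum_of_bool finite_Pow_iff)
  finally have sn: "M * m \<le> (\<Sum>X\<in>Pow I. n X)" .
  \<comment> \<open>This is the derivative of the convex function at \<open>m\<close>; its sign lets
    the lower bound on the sum of \<open>n\<close> be used in the tangent inequality.\<close>
  have slope: "0 \<le> 2 * ((q + 1) * m - N)"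
  proof -
    have "2 * m \<le> (q + 1) * m"
      using assms(2,7) by (intro mult_right_mono) (auto simp: m_def N_def)
    moreover have "N \<le> 2 * m" using assms(2) by (simp add: m_def N_def distrib_right)
    ultimately have "N \<le> (q + 1) * m" by (rule order_trans[rotated])
    then show ?thesis by simp
  qed
  have "M * (q * m\<^sup>2 + (N - m)\<^sup>2) \<le> M * (q * m\<^sup>2 + (N - m)\<^sup>2) + 2 * ((q + 1) * m - N) * ((\<Sum>X\<in>Pow I. n X) - M * m)"
    using slope sn by simp
  also have "\<dots> = (\<Sum>X\<in>Pow I. (q * m\<^sup>2 + (N - m)\<^sup>2) + 2 * ((q + 1) * m - N) * (n X - m))"
    by (simp add: sum.distrib sum_distrib_left[symmetric] sum_subtractf cM)
  also have "\<dots> \<le> (\<Sum>X\<in>Pow I. q * (n X)\<^sup>2 + (N - n X)\<^sup>2)"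
  proof (rule sum_mono)
    fix X
    have "0 \<le> (q + 1) * (n X - m)\<^sup>2" by simp
    then show "(q * m\<^sup>2 + (N - m)\<^sup>2) + 2 * ((q + 1) * m - N) * (n X - m) \<le> q * (n X)\<^sup>2 + (N - n X)\<^sup>2"
      by (simp add: power2_eq_square algebra_simps)
  qed
  also have "\<dots> \<le> (\<Sum>X\<in>Pow I. real q * (\<Sum>P\<in>L. \<Sum>Q\<in>L. of_bool (P X = Q X)))"
  proof (rule sum_mono)
    fix X assume "X \<in> Pow I"
    then show "q * (n X)\<^sup>2 + (N - n X)\<^sup>2 \<le> real q * (\<Sum>P\<in>L. \<Sum>Q\<in>L. of_bool (P X = Q X))"
      unfolding n_def N_def using assms f' val by (intro pair_count_lower[where H = H]) auto
  qed
  also have "\<dots> = q * (\<Sum>P\<in>L. \<Sum>Q\<in>L. real (card {X \<in> Pow I. P X = Q X}))"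
    using assms(1,3) by (simp only: sum_pairs_card finite_Pow_iff sum_distrib_left[symmetric])
  finally show ?thesis by (simp add: m_def M_def N_def power2_eq_square algebra_simps)
qed

text \<open>Two members that agree with \<open>f\<close> at a point agree with each other there. The
  degree condition can therefore be put on mutual agreement, without mentioning
  \<open>f\<close>.\<close>

lemma list_johnson:
  fixes f :: "'i set \<Rightarrow> 'b" and \<epsilon> d :: real
  assumes "finite I" "0 < \<epsilon>" "finite L" "0 \<le> d" and close: "\<And>P. P \<in> L \<Longrightarrow> close_on I \<epsilon> f P"
    and deg: "\<And>P. P \<in> L \<Longrightarrow>
      real (card {Q \<in> L. Q \<noteq> P \<and> 2 ^ card I < 4 * card {X. X \<subseteq> I \<and> P X = Q X}}) \<le> d"
  shows "real (card L) \<le> (1 / \<epsilon>) * (1 + d)"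
proof -
  have "\<epsilon> * card L \<le> 1 + d"
  proof (rule johnson_degree[where \<Omega> = "Pow I" and R = "\<lambda>P X. f X = P X"])
    fix P assume P: "P \<in> L"
    show "(1/2 + \<epsilon>) * card (Pow I) \<le> card {X \<in> Pow I. f X = P X}"
      using close[OF P] assms(1) by (simp add: close_on_def card_Pow)
    have "card {X \<in> Pow I. f X = P X \<and> f X = Q X} \<le> card {X. X \<subseteq> I \<and> P X = Q X}" for Q
      using assms(1) by (intro card_mono) auto
    then have "4 * card {X \<in> Pow I. f X = P X \<and> f X = Q X} \<le> 4 * card {X. X \<subseteq> I \<and> P X = Q X}" for Q
      by (rule mult_le_mono2)
    then have "{Q \<in> L. Q \<noteq> P \<and> card (Pow I) < 4 * card {X \<in> Pow I. f X = P X \<and> f X = Q X}}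
        \<subseteq> {Q \<in> L. Q \<noteq> P \<and> 2 ^ card I < 4 * card {X. X \<subseteq> I \<and> P X = Q X}}"
      unfolding card_Pow[OF assms(1)] by (blast intro: less_le_trans)
    then have "card {Q \<in> L. Q \<noteq> P \<and> card (Pow I) < 4 * card {X \<in> Pow I. f X = P X \<and> f X = Q X}}
        \<le> card {Q \<in> L. Q \<noteq> P \<and> 2 ^ card I < 4 * card {X. X \<subseteq> I \<and> P X = Q X}}"
      using assms(3) by (intro card_mono) auto
    then show "real (card {Q \<in> L. Q \<noteq> P \<and> card (Pow I) < 4 * card {X \<in> Pow I. f X = P X \<and> f X = Q X}}) \<le> d"
      using deg[OF P] by linarith
  qed (use assms in auto)
  then show ?thesis using assms(2) by (simp add: field_simps)
qed

text \<open>Toggling single coordinates connects every subset to the empty set, so the property is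
  constant over the cube.\<close>

lemma subset_propagate:
  assumes "finite I" "B \<subseteq> I" "S B" "X \<subseteq> I"
    and step: "\<And>X i. X \<subseteq> I \<Longrightarrow> i \<in> I \<Longrightarrow> i \<notin> X \<Longrightarrow> S X \<longleftrightarrow> S (insert i X)"
  shows "S X"
proof -
  have "S X \<longleftrightarrow> S {}" if "X \<subseteq> I" for X
    using finite_subset[OF that assms(1)] that
    by (induction X) (use step in auto)
  then show ?thesis using assms by blast
qed

text \<open>The following bounds are evaluated at \<open>x = 1 / \<epsilon>\<close>.\<close>

definition cyclic_bound :: "real \<Rightarrow> real" where
  "cyclic_bound x = x\<^sup>2 + 2 * x * (1 + sparse_bound 6 6 x)"

definition exponent_bound :: "real \<Rightarrow> real" where
  "exponent_bound x = x * (1 + x * (1 + (cyclic_bound x + x)))"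

definition list_bound :: "real \<Rightarrow> real" where
  "list_bound x = x * (1 + (sparse_bound 16 16 x + exponent_bound x + exponent_bound x * exponent_bound x))"

lemma bounds_nonneg: "0 \<le> x \<Longrightarrow> 0 \<le> cyclic_bound x" "0 \<le> x \<Longrightarrow> 0 \<le> exponent_bound x"
  using sparse_bound_nonneg[of x 6 6] by (auto simp: cyclic_bound_def exponent_bound_def)

section \<open>Values in a cyclic group of order two or three\<close>

context comm_group
begin

lemma pow_two_eq_one:
  assumes "x \<in> carrier G" "x [^] (2::nat) = \<one>"
  shows "x \<otimes> x = \<one>" "inv x = x"
proof -
  show "x \<otimes> x = \<one>" using assms by (simp add: numeral_2_eq_2)
  then show "inv x = x" using inv_equality[of x x] assms(1) by simp
qed

lemma pow_three_eq_one:
  assumes "x \<in> carrier G" "x [^] (3::nat) = \<one>"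
  shows "x \<otimes> x = inv x" "inv x \<otimes> inv x = x"
proof -
  have "x \<otimes> x \<otimes> x = \<one>" using assms by (simp add: numeral_3_eq_3)
  then have *: "inv x = x \<otimes> x" using inv_equality[of "x \<otimes> x" x] assms(1) by simp
  have "inv x \<otimes> inv x = inv (x \<otimes> x)" using inv_mult[of x x] assms(1) by simp
  also have "\<dots> = inv (inv x)" by (simp only: *)
  also have "\<dots> = x" using assms(1) by simp
  finally show "inv x \<otimes> inv x = x" .
  show "x \<otimes> x = inv x" using * by (rule sym)
qed

text \<open>The subgroup generated by \<open>v\<close> if its square or cube is one; for other
  \<open>v\<close> merely the set of slopes that \<open>affine_quarter\<close> allows.\<close>

definition cyc :: "'a \<Rightarrow> 'a set" where "cyc v = {\<one>, v, inv v}"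

lemma cyc_closed:
  assumes "v \<in> carrier G" "v [^] (2::nat) = \<one> \<or> v [^] (3::nat) = \<one>" "x \<in> cyc v" "y \<in> cyc v"
  shows "x \<otimes> y \<in> cyc v" "inv x \<in> cyc v"
proof -
  have "(v \<otimes> v = \<one> \<and> inv v = v) \<or> (v \<otimes> v = inv v \<and> inv v \<otimes> inv v = v)"
    using assms(1,2) pow_two_eq_one pow_three_eq_one by blast
  then show "x \<otimes> y \<in> cyc v" "inv x \<in> cyc v"
    using assms(1,3,4) by (auto simp: cyc_def)
qed

lemma cyc_carrier: "v \<in> carrier G \<Longrightarrow> x \<in> cyc v \<Longrightarrow> x \<in> carrier G"
  by (auto simp: cyc_def)

lemma close_on_translate:
  assumes "finite I" "close_on I \<epsilon> f Q"
  shows "close_on I \<epsilon> (\<lambda>X. f X \<otimes> inv (P X)) (affine_div I Q P)"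
proof -
  have "card {X. X \<subseteq> I \<and> f X = Q X} \<le> card {X. X \<subseteq> I \<and> f X \<otimes> inv (P X) = affine_div I Q P X}"
    using assms(1) by (intro card_mono) (auto simp: affine_div_apply)
  then show ?thesis using assms(2) by (simp add: close_on_def)
qed

text \<open>Division by \<open>P\<close> is injective and preserves closeness once \<open>f\<close>
  is divided too, so the surroundings of \<open>P\<close> are counted as if \<open>P\<close> were
  the trivial function.\<close>

lemma card_le_by_translation:
  assumes "finite I" "finite L" "L \<subseteq> affine_on I" "P \<in> affine_on I" "\<And>Q. Q \<in> L \<Longrightarrow> close_on I \<epsilon> f Q"
    and "\<And>L' f'. finite L' \<Longrightarrow> L' \<subseteq> affine_on I \<Longrightarrow> (\<And>D. D \<in> L' \<Longrightarrow> close_on I \<epsilon> f' D) \<Longrightarrow>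
      (\<And>D. D \<in> L' \<Longrightarrow> \<exists>Q\<in>L. D = affine_div I Q P) \<Longrightarrow> real (card L') \<le> B"
  shows "real (card L) \<le> B"
proof -
  have "inj_on (\<lambda>Q. affine_div I Q P) L"
    using affine_div_inj[OF assms(4)] assms(3) inj_on_subset by blast
  then have "card ((\<lambda>Q. affine_div I Q P) ` L) = card L" by (rule card_image)
  moreover have "real (card ((\<lambda>Q. affine_div I Q P) ` L)) \<le> B"
    using assms(2,5) close_on_translate[OF assms(1)] affine_div_affine[OF subsetD[OF assms(3)] assms(4)]
    by (intro assms(6)[of _ "\<lambda>X. f X \<otimes> inv (P X)"]) auto
  ultimately show ?thesis by simp
qed

text \<open>The lower bound on agreeing pairs meets \<open>pair_sum_le\<close>. For order two the
  main terms are both 1/2, since distinct members agree on at most half of the cube, and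
  \<open>2 * \<epsilon>^2 * N \<le> 1\<close> remains. For order three they are both 3/4, and
  \<open>\<epsilon> * N\<close> is bounded by the number of partners with agreement above 3/8.
  \<open>cyclic_bound\<close> adds the two cases.\<close>

lemma list_cyclic:
  fixes \<epsilon> :: real and f :: "'i set \<Rightarrow> 'a"
  assumes "finite I" "0 < \<epsilon>" "finite L" "L \<subseteq> affine_on I" and v: "v \<in> carrier G"
    and ord: "v [^] (2::nat) = \<one> \<or> v [^] (3::nat) = \<one>"
    and val: "\<And>P X. P \<in> L \<Longrightarrow> X \<subseteq> I \<Longrightarrow> P X \<in> cyc v"
    and close: "\<And>P. P \<in> L \<Longrightarrow> close_on I \<epsilon> f P"
  shows "real (card L) \<le> cyclic_bound (1 / \<epsilon>)"
proof (cases "L = {}")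
  case True
  then show ?thesis using bounds_nonneg(1)[of "1 / \<epsilon>"] assms(2) by simp
next
  case False
  define N where "N = real (card L)"
  define M where "M = (2::real) ^ card I"
  have N: "N > 0" and M: "M > 0" using False assms by (auto simp: N_def M_def card_gt_0_iff)
  have alpha: "real (card {X. X \<subseteq> I \<and> P X = Q X}) \<le> M" for P Q :: "'i set \<Rightarrow> 'a"
    using card_mono[of "Pow I" "{X. X \<subseteq> I \<and> P X = Q X}"] assms(1)
    by (auto simp: M_def card_Pow intro: order_trans[OF of_nat_mono])
  have sp: "0 \<le> sparse_bound 6 6 (1 / \<epsilon>)" using assms(2) by (simp add: sparse_bound_nonneg)
  show ?thesis
  proof (cases "v [^] (2::nat) = \<one>")
    case True
    then have "v \<otimes> v = \<one>" using v by (simp add: numeral_2_eq_2)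
    then have "inv v = v" using inv_equality[of v v] v by simp
    then have H: "finite (cyc v)" "cyc v \<noteq> {}" "card (cyc v) \<le> Suc 1" by (auto simp: cyc_def card_insert_if)
    have "2 ^ card I * (real ((card L)\<^sup>2) * (real 1 * (1/2 + \<epsilon>)\<^sup>2 + (1/2 - \<epsilon>)\<^sup>2))
        \<le> real 1 * (\<Sum>P\<in>L. \<Sum>Q\<in>L. real (card {X. X \<subseteq> I \<and> P X = Q X}))"
      by (rule list_pair_agreement_lower[where H = "cyc v" and f = f]) (use assms H in auto)
    then have "M * (N\<^sup>2 * (1 * (1/2 + \<epsilon>)\<^sup>2 + (1/2 - \<epsilon>)\<^sup>2))
        \<le> (\<Sum>P\<in>L. \<Sum>Q\<in>L. real (card {X. X \<subseteq> I \<and> P X = Q X}))"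
      by (simp add: N_def M_def)
    also have "\<dots> \<le> N * (M * (1 + 0) + (M / 2) * N)"
      unfolding N_def
    proof (rule pair_sum_le)
      fix P assume P: "P \<in> L"
      have "\<not> M / 2 < real (card {X. X \<subseteq> I \<and> P X = Q X})" if Q: "Q \<in> L" "Q \<noteq> P" for Q
      proof
        assume "M / 2 < real (card {X. X \<subseteq> I \<and> P X = Q X})"
        then have "real (2 ^ card I) < real (2 * card {X. X \<subseteq> I \<and> P X = Q X})" by (simp add: M_def)
        then have "2 ^ card I < 2 * card {X. X \<subseteq> I \<and> P X = Q X}" by (simp only: of_nat_less_iff)
        then show False using affine_eq_of_agree[of P I Q] P Q assms by auto
      qed
      then have "{Q \<in> L. Q \<noteq> P \<and> M / 2 < real (card {X. X \<subseteq> I \<and> P X = Q X})} = {}" by blast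
      then show "real (card {Q \<in> L. Q \<noteq> P \<and> M / 2 < real (card {X. X \<subseteq> I \<and> P X = Q X})}) \<le> 0"
        by (simp only: card.empty)
    qed (use alpha assms M in auto)
    finally have "(M * N) * (N * (1/2 + 2 * \<epsilon>\<^sup>2)) \<le> (M * N) * (1 + N / 2)"
      by (simp add: power2_eq_square algebra_simps)
    then have "N * (1/2 + 2 * \<epsilon>\<^sup>2) \<le> 1 + N / 2" using M N by simp
    then have "2 * (\<epsilon>\<^sup>2 * N) \<le> 1" by (simp add: algebra_simps)
    moreover have "0 \<le> \<epsilon>\<^sup>2 * N" using N by simp
    ultimately have "\<epsilon>\<^sup>2 * N \<le> 1" by linarith
    then have "N \<le> (1 / \<epsilon>)\<^sup>2" using assms(2) by (simp add: field_simps)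
    moreover have "0 \<le> 2 * (1 / \<epsilon>) * (1 + sparse_bound 6 6 (1 / \<epsilon>))" using sp assms(2) by simp
    ultimately show ?thesis unfolding cyclic_bound_def N_def by linarith
  next
    case False
    then have v3: "v [^] (3::nat) = \<one>" using ord by blast
    have "v \<noteq> \<one>" using False by auto
    then have small: "v [^] k \<noteq> \<one>" if "1 \<le> k" "k < 3" for k :: nat
    proof -
      have "k = 1 \<or> k = 2" using that by auto
      then show ?thesis using False \<open>v \<noteq> \<one>\<close> v by auto
    qed
    have H: "finite (cyc v)" "cyc v \<noteq> {}" "card (cyc v) \<le> Suc 2" by (auto simp: cyc_def card_insert_if)
    define d where "d = sparse_bound 6 6 (1 / \<epsilon>)"
    have "2 ^ card I * (real ((card L)\<^sup>2) * (real 2 * (1/2 + \<epsilon>)\<^sup>2 + (1/2 - \<epsilon>)\<^sup>2))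
        \<le> real 2 * (\<Sum>P\<in>L. \<Sum>Q\<in>L. real (card {X. X \<subseteq> I \<and> P X = Q X}))"
      by (rule list_pair_agreement_lower[where H = "cyc v" and f = f]) (use assms H in auto)
    then have "M * (N\<^sup>2 * (2 * (1/2 + \<epsilon>)\<^sup>2 + (1/2 - \<epsilon>)\<^sup>2))
        \<le> 2 * (\<Sum>P\<in>L. \<Sum>Q\<in>L. real (card {X. X \<subseteq> I \<and> P X = Q X}))"
      by (simp add: N_def M_def)
    \<comment> \<open>The threshold 3/8 is half of the main term 3/4, and equals the density 6/16 of
      \<open>binomial_4_gap_3\<close>. Agreement above it makes the quotient have at most six
      nontrivial slopes, so such partners are counted by \<open>list_sparse\<close>.\<close>
    also have "(\<Sum>P\<in>L. \<Sum>Q\<in>L. real (card {X. X \<subseteq> I \<and> P X = Q X})) \<le> N * (M * (1 + d) + (3 / 8 * M) * N)"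
      unfolding N_def
    proof (rule pair_sum_le)
      fix P assume P: "P \<in> L"
      define J where "J = {Q \<in> L. Q \<noteq> P \<and> 3 / 8 * M < real (card {X. X \<subseteq> I \<and> P X = Q X})}"
      have "real (card J) \<le> d"
      proof (rule card_le_by_translation[where P = P])
        fix L' f' assume L': "finite L'" "L' \<subseteq> affine_on I" "\<And>D. D \<in> L' \<Longrightarrow> close_on I \<epsilon> f' D"
          "\<And>D. D \<in> L' \<Longrightarrow> \<exists>Q\<in>J. D = affine_div I Q P"
        show "real (card L') \<le> d" unfolding d_def
        proof (rule list_sparse[OF assms(1,2) L'(1,2) _ L'(3)])
          fix D assume D: "D \<in> L'"
          then obtain Q where Q: "Q \<in> J" "D = affine_div I Q P" using L' by blast
          have aff: "P \<in> affine_on I" "Q \<in> affine_on I" "Q \<in> L" using P Q assms by (auto simp: J_def)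
          have sl: "slope D i \<in> {\<one>, v, inv v}" if "i \<in> I" for i
          proof -
            have "slope R i \<in> cyc v" if "R \<in> L" for R
              unfolding slope_def using val[OF that, of "{}"] val[OF that, of "{i}"] \<open>i \<in> I\<close> cyc_closed[OF v ord] by simp
            then have "slope Q i \<otimes> inv (slope P i) \<in> cyc v" using cyc_closed[OF v ord] P aff by blast
            then show ?thesis using slope_affine_div[OF aff(2,1) that] Q by (simp add: cyc_def)
          qed
          have "{X. X \<subseteq> I \<and> D X = \<one>} = {X. X \<subseteq> I \<and> P X = Q X}"
            using affine_div_eq_one_iff[OF aff(2,1)] Q by auto
          moreover have "real (6 * 2 ^ card I) < real (2 ^ Suc 3 * card {X. X \<subseteq> I \<and> P X = Q X})"
            using Q by (simp add: J_def M_def)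
          ultimately have "6 * 2 ^ card I < 2 ^ Suc 3 * card {X. X \<subseteq> I \<and> D X = \<one>}"
            by (simp only: of_nat_less_iff)
          then have "card (support I D) \<le> 2 * 3"
            using D L' assms v sl small binomial_4_gap_3
            by (intro support_card_le[where q = 3 and c = 6 and v = v]) (auto simp: numeral_eq_Suc)
          then show "card (support I D) \<le> 6" by simp
        qed
      qed (use P assms in \<open>auto simp: J_def\<close>)
      then show "real (card {Q \<in> L. Q \<noteq> P \<and> 3 / 8 * M < real (card {X. X \<subseteq> I \<and> P X = Q X})}) \<le> d"
        by (simp add: J_def)
    qed (use alpha assms M in auto)
    finally have "(M * N) * (N * (3/4 + \<epsilon> + 3 * \<epsilon>\<^sup>2)) \<le> (M * N) * (2 * (1 + d) + 3/4 * N)"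
      by (simp add: power2_eq_square algebra_simps)
    then have "N * (3/4 + \<epsilon> + 3 * \<epsilon>\<^sup>2) \<le> 2 * (1 + d) + 3/4 * N" using M N by simp
    then have "N * \<epsilon> + 3 * (\<epsilon>\<^sup>2 * N) \<le> 2 * (1 + d)" by (simp add: algebra_simps)
    moreover have "0 \<le> \<epsilon>\<^sup>2 * N" using N by simp
    ultimately have "N * \<epsilon> \<le> 2 * (1 + d)" by linarith
    then have "N \<le> 2 * (1 / \<epsilon>) * (1 + d)" using assms(2) by (simp add: field_simps)
    moreover have "0 \<le> (1 / \<epsilon>)\<^sup>2" by simp
    ultimately show ?thesis unfolding cyclic_bound_def N_def d_def by linarith
  qed
qed

section \<open>The neighbours of a neighbour\<close>

lemma affine_propagate:
  assumes D: "D \<in> affine_on I" and "finite I" "X0 \<subseteq> I" "D X0 \<in> H" "X \<subseteq> I"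
    and H: "H \<subseteq> carrier G" "\<And>x y. x \<in> H \<Longrightarrow> y \<in> H \<Longrightarrow> x \<otimes> y \<in> H" "\<And>x. x \<in> H \<Longrightarrow> inv x \<in> H"
    and slope: "\<And>i. i \<in> I \<Longrightarrow> slope D i \<in> H"
  shows "D X \<in> H"
proof (rule subset_propagate[where B = X0 and S = "\<lambda>X. D X \<in> H" and I = I])
  fix X i assume X: "X \<subseteq> I" "i \<in> I" "i \<notin> X"
  have c: "D X \<in> carrier G" "slope D i \<in> carrier G" using affine_closed[OF D X(1)] D X by auto
  have e: "D (insert i X) = D X \<otimes> slope D i" using affine_insert[OF D] X by blast
  then have "D X = D (insert i X) \<otimes> inv (slope D i)" using c by (simp add: m_assoc)
  then show "D X \<in> H \<longleftrightarrow> D (insert i X) \<in> H" using e H(2,3) slope[OF X(2)] by metis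
qed (use assms in auto)

lemma cyc_swap:
  assumes "w \<in> carrier G" "v \<in> cyc w" "v \<noteq> \<one>"
  shows "cyc v = cyc w"
  using assms by (auto simp: cyc_def)

lemma cyc_mult_cancel:
  assumes "w \<in> carrier G" "w [^] (2::nat) = \<one> \<or> w [^] (3::nat) = \<one>"
    and "x \<in> carrier G" "y \<in> cyc w" "x \<otimes> y \<in> cyc w"
  shows "x \<in> cyc w"
proof -
  have y: "y \<in> carrier G" using assms cyc_carrier by blast
  have "x = x \<otimes> y \<otimes> inv y" using assms(3) y by (simp add: m_assoc)
  then show ?thesis using cyc_closed[OF assms(1,2)] assms(4,5) by metis
qed

text \<open>The element supplied by \<open>affine_quarter\<close> is exchanged for an actual slope
  \<open>v\<close> of \<open>D\<close>. One exists because \<open>D\<close> takes the value one and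
  also another value; a point \<open>X0\<close> with value one is kept as an anchor for
  propagation.\<close>

lemma neighbour_slopes:
  assumes D: "D \<in> affine_on I" and "finite I" and ne: "\<exists>X\<subseteq>I. D X \<noteq> \<one>"
    and dense: "2 ^ card I < 4 * card {X. X \<subseteq> I \<and> D X = \<one>}"
  obtains v i X0 where "v \<in> carrier G" "v \<noteq> \<one>" "\<And>i. i \<in> I \<Longrightarrow> slope D i \<in> cyc v"
    "i \<in> I" "slope D i = v" "X0 \<subseteq> I" "D X0 = \<one>"
proof -
  obtain u where u: "u \<in> carrier G" "\<And>i. i \<in> I \<Longrightarrow> slope D i \<in> cyc u"
    using affine_quarter[OF D \<open>finite I\<close> dense] unfolding cyc_def by metis
  have "{X. X \<subseteq> I \<and> D X = \<one>} \<noteq> {}" using dense by (metis card.empty mult_0_right not_less_zero)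
  then obtain X0 where X0: "X0 \<subseteq> I" "D X0 = \<one>" by blast
  have "support I D \<noteq> {}"
  proof
    assume "support I D = {}"
    then have "D X = D {}" if "X \<subseteq> I" for X
      using affine_depends_on_support[OF D \<open>finite I\<close>, of "{}" X] that by simp
    then show False using ne X0 by metis
  qed
  then obtain i where i: "i \<in> I" "slope D i \<noteq> \<one>" by (auto simp: support_def)
  have "cyc (slope D i) = cyc u" using cyc_swap[OF u(1) u(2)[OF i(1)] i(2)] .
  then show ?thesis using that[of "slope D i" i X0] i X0 u D by simp
qed

text \<open>Every \<open>E\<close> in \<open>J\<close> arises from \<open>D\<close> by sending
  \<open>v\<close> to some \<open>w\<close>. Where \<open>D\<close> is one, all of \<open>J\<close>
  is one. At any other point the value of \<open>E\<close> reveals \<open>w\<close> and thereby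
  \<open>E\<close>, so at most one member agrees with \<open>f\<close> there. As \<open>D\<close> is
  one on at most half of the cube, the excess \<open>\<epsilon>\<close> must be paid for by the
  other points.\<close>

lemma list_graph:
  fixes \<epsilon> :: real
  assumes "finite I" "0 < \<epsilon>" "finite J" and D: "D \<in> affine_on I" and ne: "\<exists>X\<subseteq>I. D X \<noteq> \<one>"
    and J: "J \<subseteq> affine_on I"
    and rel: "\<And>E. E \<in> J \<Longrightarrow> \<exists>w\<in>carrier G. (v = inv v \<longrightarrow> w = inv w) \<and> (\<forall>X\<subseteq>I. (D X, E X) \<in> {(\<one>, \<one>), (v, w), (inv v, inv w)})"
    and v: "v \<in> carrier G" "v \<noteq> \<one>"
    and close: "\<And>E. E \<in> J \<Longrightarrow> close_on I \<epsilon> f E"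
  shows "real (card J) \<le> 1 / \<epsilon>"
proof -
  define M where "M = (2::real) ^ card I"
  define Z where "Z = {X. X \<subseteq> I \<and> D X = \<one>}"
  have M: "M > 0" by (simp add: M_def)
  have cM: "real (card (Pow I)) = M" using assms(1) by (simp add: card_Pow M_def)
  have "2 * card Z \<le> 2 ^ card I" unfolding Z_def using D ne assms(1) by (intro affine_half)
  then have "real (2 * card Z) \<le> real (2 ^ card I)" by (simp only: of_nat_le_iff)
  then have Zh: "real (card Z) \<le> M / 2" by (simp add: M_def)
  have inj: "E = E'" if EE: "E \<in> J" "E' \<in> J" "X \<subseteq> I" "D X \<noteq> \<one>" "E X = E' X" for E E' X
  proof -
    have vi: "\<one> \<noteq> inv v" using v inv_eq_1_iff[of v] by metis
    \<comment> \<open>The clause on \<open>v = inv v\<close> makes the assignment of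
      \<open>w\<close> and \<open>inv w\<close> consistent when the two nontrivial values of
      \<open>D\<close> coincide.\<close>
    have val: "y = (if d = \<one> then \<one> else if d = v then u else inv u)"
      if "(d, y) \<in> {(\<one>, \<one>), (v, u), (inv v, inv u)}" "v = inv v \<longrightarrow> u = inv u" for d y u
      using that v vi by auto
    obtain w where w: "w \<in> carrier G" "v = inv v \<longrightarrow> w = inv w"
        "\<And>X. X \<subseteq> I \<Longrightarrow> (D X, E X) \<in> {(\<one>, \<one>), (v, w), (inv v, inv w)}"
      using rel[OF EE(1)] by metis
    obtain w' where w': "w' \<in> carrier G" "v = inv v \<longrightarrow> w' = inv w'"
        "\<And>X. X \<subseteq> I \<Longrightarrow> (D X, E' X) \<in> {(\<one>, \<one>), (v, w'), (inv v, inv w')}"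
      using rel[OF EE(2)] by metis
    have "(if D X = v then w else inv w) = (if D X = v then w' else inv w')"
      using val[OF w(3)[OF EE(3)] w(2)] val[OF w'(3)[OF EE(3)] w'(2)] EE(4,5) by simp
    then have "w = w'" using w(1) w'(1) by (metis inv_inv)
    then have "E Y = E' Y" if "Y \<subseteq> I" for Y
      using val[OF w(3)[OF that] w(2)] val[OF w'(3)[OF that] w'(2)] by simp
    then show ?thesis using affine_eqI EE J by blast
  qed
  have pt: "(\<Sum>E\<in>J. of_bool (f X = E X)) \<le> real (card J) * of_bool (X \<in> Z) + (1::real)" if X: "X \<in> Pow I" for X
  proof (cases "X \<in> Z")
    case True
    have "(\<Sum>E\<in>J. of_bool (f X = E X)) \<le> of_nat (card J) * (1::real)"
      by (rule sum_bounded_above) simp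
    then show ?thesis using True by simp
  next
    case False
    then have "D X \<noteq> \<one>" using X by (simp add: Z_def)
    then have "E = E'" if "E \<in> {E \<in> J. f X = E X}" "E' \<in> {E \<in> J. f X = E X}" for E E'
      using inj[of E E' X] that X by auto
    then have "card {E \<in> J. f X = E X} \<le> Suc 0"
      using assms(3) by (subst card_le_Suc0_iff_eq) auto
    then have "real (card {E \<in> J. f X = E X}) \<le> 1" by simp
    then show ?thesis using False card_eq_sum_of_bool[OF assms(3), of "\<lambda>E. f X = E X"] by simp
  qed
  have "card J * ((1/2 + \<epsilon>) * M) \<le> (\<Sum>E\<in>J. real (card {X \<in> Pow I. f X = E X}))"
    using sum_bounded_below[of J "(1/2 + \<epsilon>) * M" "\<lambda>E. real (card {X \<in> Pow I. f X = E X})"] close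
    by (simp add: M_def close_on_def)
  also have "\<dots> = (\<Sum>X\<in>Pow I. \<Sum>E\<in>J. of_bool (f X = E X))"
    using assms(1) by (subst sum.swap) (simp only: card_eq_sum_of_bool finite_Pow_iff)
  also have "\<dots> \<le> (\<Sum>X\<in>Pow I. real (card J) * of_bool (X \<in> Z) + 1)" by (rule sum_mono[OF pt])
  also have "\<dots> = card J * real (card {X \<in> Pow I. X \<in> Z}) + M"
    using assms(1) cM by (simp only: sum.distrib sum_distrib_left[symmetric] card_eq_sum_of_bool finite_Pow_iff) simp
  also have "{X \<in> Pow I. X \<in> Z} = Z" by (auto simp: Z_def)
  also have "card J * real (card Z) + M \<le> card J * (M / 2) + M"
    using Zh by (intro add_right_mono mult_left_mono) auto
  finally have "M * (\<epsilon> * card J) \<le> M * 1" by (simp add: algebra_simps)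
  then have "\<epsilon> * card J \<le> 1" using M by simp
  then show ?thesis using assms(2) by (simp add: field_simps)
qed

text \<open>Both functions and, by their agreement, also their quotient have slopes in some
  \<open>cyc\<close>. Since the groups of \<open>v\<close> and \<open>w\<close> meet only in one,
  this forces the slopes of \<open>D\<close> and \<open>E\<close> to be trivial together and to
  match up to one common choice of sign. The admissible pairs form a subgroup \<open>R\<close>, and
  membership in \<open>R\<close> spreads from a point of agreement to the whole cube.\<close>

lemma neighbour_graph:
  fixes e :: nat
  assumes DE: "D \<in> affine_on I" "E \<in> affine_on I" and "finite I" and e: "e = 2 \<or> e = 3"
    and v: "v \<in> carrier G" "v \<noteq> \<one>" "v [^] e = \<one>" and w: "w \<in> carrier G" "w \<noteq> \<one>" "w [^] e = \<one>"
    and sD: "\<And>i. i \<in> I \<Longrightarrow> slope D i \<in> cyc v" and sE: "\<And>i. i \<in> I \<Longrightarrow> slope E i \<in> cyc w"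
    and iD: "i \<in> I" "slope D i = v" and iE: "j \<in> I" "slope E j = w"
    and zD: "X0 \<subseteq> I" "D X0 = \<one>" and zE: "X1 \<subseteq> I" "E X1 = \<one>"
    and agree: "2 ^ card I < 4 * card {X. X \<subseteq> I \<and> D X = E X}"
    and wv: "w \<notin> cyc v"
  shows "\<exists>w\<in>carrier G. (v = inv v \<longrightarrow> w = inv w) \<and> (\<forall>X\<subseteq>I. (D X, E X) \<in> {(\<one>, \<one>), (v, w), (inv v, inv w)})"
proof -
  have ve: "v [^] (2::nat) = \<one> \<or> v [^] (3::nat) = \<one>" and we: "w [^] (2::nat) = \<one> \<or> w [^] (3::nat) = \<one>"
    using e v w by auto
  have vw: "v \<notin> cyc w" using cyc_swap[OF w(1) _ v(2)] wv by (auto simp: cyc_def)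
  have disj: "x = \<one>" if "x \<in> cyc v" "x \<in> cyc w" for x
    using cyc_swap[OF v(1) that(1)] cyc_swap[OF w(1) that(2)] wv by (auto simp: cyc_def)
  have cl: "x \<in> carrier G" if "x \<in> cyc v \<or> x \<in> cyc w" for x
    using that v w cyc_carrier by blast
  obtain u where u: "u \<in> carrier G" "\<And>k. k \<in> I \<Longrightarrow> slope D k \<otimes> inv (slope E k) \<in> cyc u"
  proof -
    have "{X. X \<subseteq> I \<and> affine_div I D E X = \<one>} = {X. X \<subseteq> I \<and> D X = E X}"
      using affine_div_eq_one_iff[OF DE] by blast
    then have "2 ^ card I < 4 * card {X. X \<subseteq> I \<and> affine_div I D E X = \<one>}" using agree by simp
    then obtain u where "u \<in> carrier G" "\<And>k. k \<in> I \<Longrightarrow> slope (affine_div I D E) k \<in> {\<one>, u, inv u}"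
      using affine_quarter[OF affine_div_affine[OF DE] \<open>finite I\<close>] by metis
    then show ?thesis using that[of u] slope_affine_div[OF DE] by (simp add: cyc_def)
  qed
  define q where "q k = slope D k \<otimes> inv (slope E k)" for k
  have q_closed: "q k \<in> carrier G" if "k \<in> I" for k using that DE by (simp add: q_def)
  \<comment> \<open>Otherwise the quotient has a nontrivial slope in \<open>cyc w\<close>, so all
    its slopes lie there; the one at \<open>i\<close> then puts \<open>v\<close> into
    \<open>cyc w\<close>.\<close>
  have E_one: "slope E k = \<one>" if k: "k \<in> I" "slope D k = \<one>" for k
  proof (rule ccontr)
    assume ne: "slope E k \<noteq> \<one>"
    then have qk: "q k \<in> cyc w" "q k \<noteq> \<one>"
      using k DE cyc_closed(2)[OF w(1) we sE[OF k(1)]] sE[OF k(1)] by (auto simp: q_def)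
    then have "cyc u = cyc w"
      using cyc_swap[OF w(1) qk] cyc_swap[OF u(1) u(2)[OF k(1), folded q_def] qk(2)] by simp
    then have "v \<otimes> inv (slope E i) \<in> cyc w" using u(2)[OF iD(1)] iD by simp
    moreover have "inv (slope E i) \<in> cyc w" using cyc_closed(2)[OF w(1) we sE[OF iD(1)] sE[OF iD(1)]] .
    ultimately show False using cyc_mult_cancel[OF w(1) we v(1)] vw by blast
  qed
  have D_one: "slope D k = \<one>" if k: "k \<in> I" "slope E k = \<one>" for k
  proof (rule ccontr)
    assume ne: "slope D k \<noteq> \<one>"
    then have qk: "q k \<in> cyc v" "q k \<noteq> \<one>" using k DE sD[OF k(1)] by (auto simp: q_def)
    then have "cyc u = cyc v"
      using cyc_swap[OF v(1) qk] cyc_swap[OF u(1) u(2)[OF k(1), folded q_def] qk(2)] by simp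
    then have "slope D j \<otimes> inv w \<in> cyc v" using u(2)[OF iE(1)] iE by simp
    then have "inv w \<in> cyc v"
      using cyc_mult_cancel[OF v(1) ve, of "inv w" "slope D j"] sD[OF iE(1)] w(1) DE iE(1) by (simp add: m_comm)
    then have "inv (inv w) \<in> cyc v" using cyc_closed(2)[OF v(1) ve] by blast
    then show False using wv w by simp
  qed
  \<comment> \<open>The partner of \<open>v\<close>: either \<open>w\<close> or
    \<open>inv w\<close>, depending on the signs at \<open>i\<close>.\<close>
  define z where "z = slope E i"
  have z: "z \<in> carrier G" "z \<in> cyc w" "z \<noteq> \<one>"
    using sE[OF iD(1)] cl D_one[OF iD(1)] iD v by (auto simp: z_def)
  have cz: "cyc z = cyc w" using cyc_swap[OF w(1) z(2,3)] .
  have ze: "z [^] e = \<one>" using z(2) w by (auto simp: cyc_def nat_pow_inv)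
  define R where "R = {(\<one>, \<one>), (v, z), (inv v, inv z)}"
  have qi: "q i = v \<otimes> inv z" "q i \<noteq> \<one>"
    using iD v z vw mult_inv_eq_one_iff[of v z] by (auto simp: q_def z_def)
  have cu: "cyc u = {\<one>, v \<otimes> inv z, inv (v \<otimes> inv z)}"
    using cyc_swap[OF u(1) u(2)[OF iD(1), folded q_def] qi(2)] qi by (simp add: cyc_def)
  have inv_vz: "inv (v \<otimes> inv z) = inv v \<otimes> z" using v z by (simp add: inv_mult)
  have slopes: "(slope D k, slope E k) \<in> R" if k: "k \<in> I" for k
  proof (cases "slope D k = \<one>")
    case True
    then show ?thesis using E_one k by (simp add: R_def)
  next
    case False
    have a: "slope D k = v \<or> slope D k = inv v" using sD[OF k] False by (auto simp: cyc_def)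
    have b: "slope E k = z \<or> slope E k = inv z"
      using sE[OF k] D_one[OF k] False cz by (auto simp: cyc_def)
    have qk: "q k \<in> {\<one>, v \<otimes> inv z, inv v \<otimes> z}" using u(2)[OF k] cu inv_vz by (simp add: q_def)
    have "q k \<noteq> \<one>"
    proof
      assume "q k = \<one>"
      then have "slope D k = slope E k" using mult_inv_eq_one_iff DE k by (simp add: q_def)
      then show False using disj[of "slope D k"] sD[OF k] sE[OF k] False by simp
    qed
    show ?thesis
    proof (rule ccontr)
      \<comment> \<open>Mismatched signs matter only if neither \<open>v\<close> nor
        \<open>z\<close> is its own inverse. The quotient then has slope \<open>v z\<close> or its
        inverse, which \<open>cyc (v \<otimes> inv z)\<close> contains only if it is one.\<close>
      assume notR: "(slope D k, slope E k) \<notin> R"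
      then have c: "(slope D k = v \<and> slope E k = inv z) \<or> (slope D k = inv v \<and> slope E k = z)"
        and nz: "z \<noteq> inv z" and nv: "v \<noteq> inv v"
        using a b by (auto simp: R_def)
      from c show False
      proof
        assume c: "slope D k = v \<and> slope E k = inv z"
        then have "q k = v \<otimes> z" using z by (simp add: q_def)
        then have "v \<otimes> z = v \<otimes> inv z \<or> v \<otimes> z = inv v \<otimes> z" using qk \<open>q k \<noteq> \<one>\<close> by auto
        then show False using nz nv v z by simp
      next
        assume c: "slope D k = inv v \<and> slope E k = z"
        then have "q k = inv v \<otimes> inv z" by (simp add: q_def)
        then have "inv v \<otimes> inv z = v \<otimes> inv z \<or> inv v \<otimes> inv z = inv v \<otimes> z" using qk \<open>q k \<noteq> \<one>\<close> by auto
        then show False using nz nv v z by auto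
      qed
    qed
  qed
  have valD: "D X \<in> cyc v" if "X \<subseteq> I" for X
    using affine_propagate[OF DE(1) \<open>finite I\<close> zD(1) _ that, of "cyc v"] zD v sD cyc_closed[OF v(1) ve] cl
    by (auto simp: cyc_def)
  have valE: "E X \<in> cyc w" if "X \<subseteq> I" for X
    using affine_propagate[OF DE(2) \<open>finite I\<close> zE(1) _ that, of "cyc w"] zE w sE cyc_closed[OF w(1) we] cl
    by (auto simp: cyc_def)
  \<comment> \<open>At a point of agreement the common value lies in both cyclic groups, hence is
    one.\<close>
  have "{X. X \<subseteq> I \<and> D X = E X} \<noteq> {}" using agree by (metis card.empty mult_0_right not_less_zero)
  then obtain X2 where X2: "X2 \<subseteq> I" "D X2 = E X2" by blast
  then have start: "(D X2, E X2) \<in> R" using disj[of "E X2"] valD[OF X2(1)] valE[OF X2(1)] by (simp add: R_def)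
  have sq: "(z \<otimes> z = \<one> \<and> inv z = z \<and> v \<otimes> v = \<one> \<and> inv v = v) \<or>
      (z \<otimes> z = inv z \<and> inv z \<otimes> inv z = z \<and> v \<otimes> v = inv v \<and> inv v \<otimes> inv v = v)"
    using e ze v z(1) pow_two_eq_one[of z] pow_two_eq_one[of v] pow_three_eq_one[of z] pow_three_eq_one[of v]
    by blast
  then have vz: "v = inv v \<longrightarrow> z = inv z" using v z(1) l_cancel_one[of v v] by metis
  have Rmult: "(a \<otimes> a', b \<otimes> b') \<in> R" if "(a, b) \<in> R" "(a', b') \<in> R" for a b a' b'
    using that sq v(1) z(1) by (auto simp: R_def)
  have Rinv: "(inv a, inv b) \<in> R" if "(a, b) \<in> R" for a b
    using that sq v(1) z(1) by (auto simp: R_def)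
  have "(D X, E X) \<in> R" if "X \<subseteq> I" for X
  proof (rule subset_propagate[where B = X2 and I = I and S = "\<lambda>X. (D X, E X) \<in> R"])
    fix X k assume X: "X \<subseteq> I" "k \<in> I" "k \<notin> X"
    have c: "D X \<in> carrier G" "slope D k \<in> carrier G" "E X \<in> carrier G" "slope E k \<in> carrier G"
      using affine_closed[OF DE(1) X(1)] affine_closed[OF DE(2) X(1)] DE X by auto
    have eq: "D (insert k X) = D X \<otimes> slope D k" "E (insert k X) = E X \<otimes> slope E k"
      using affine_insert[OF DE(1)] affine_insert[OF DE(2)] X by auto
    have "D X = D (insert k X) \<otimes> inv (slope D k)" "E X = E (insert k X) \<otimes> inv (slope E k)"
      using c eq by (simp_all add: m_assoc)
    then show "(D X, E X) \<in> R \<longleftrightarrow> (D (insert k X), E (insert k X)) \<in> R"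
      using eq Rmult Rinv slopes[OF X(2)] by metis
  qed (use X2 start that \<open>finite I\<close> in auto)
  then show ?thesis using z(1) vz unfolding R_def by blast
qed

section \<open>From neighbourhoods to whole lists\<close>

text \<open>By \<open>list_johnson\<close> only neighbourhoods need a bound, and each is translated
  to the trivial function. The last condition on \<open>L'\<close> records the origin of the
  quotients, so that properties of \<open>L\<close> such as its exponent can be inherited.\<close>

lemma neighbours_translate:
  fixes \<epsilon> :: real and L :: "('i set \<Rightarrow> 'a) set"
  assumes "finite I" "0 < \<epsilon>" "finite L" "L \<subseteq> affine_on I" "0 \<le> d"
    and close: "\<And>P. P \<in> L \<Longrightarrow> close_on I \<epsilon> f P"
    and nb: "\<And>P L' f'. P \<in> L \<Longrightarrow> finite L' \<Longrightarrow> L' \<subseteq> affine_on I \<Longrightarrow>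
      (\<And>D. D \<in> L' \<Longrightarrow> close_on I \<epsilon> f' D) \<Longrightarrow>
      (\<And>D. D \<in> L' \<Longrightarrow> \<exists>X\<subseteq>I. D X \<noteq> \<one>) \<Longrightarrow>
      (\<And>D. D \<in> L' \<Longrightarrow> 2 ^ card I < 4 * card {X. X \<subseteq> I \<and> D X = \<one>}) \<Longrightarrow>
      (\<And>D. D \<in> L' \<Longrightarrow> \<exists>Q\<in>L. D = affine_div I Q P) \<Longrightarrow> real (card L') \<le> d"
  shows "real (card L) \<le> (1 / \<epsilon>) * (1 + d)"
proof (rule list_johnson[OF assms(1,2,3,5) close])
  fix P assume P: "P \<in> L"
  define N where "N = {Q \<in> L. Q \<noteq> P \<and> 2 ^ card I < 4 * card {X. X \<subseteq> I \<and> P X = Q X}}"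
  have aff: "Q \<in> affine_on I" if "Q \<in> L" for Q using that assms by blast
  have "real (card N) \<le> d"
  proof (rule card_le_by_translation[where P = P and L = N and f = f])
    fix L' f' assume L': "finite L'" "L' \<subseteq> affine_on I" "\<And>D. D \<in> L' \<Longrightarrow> close_on I \<epsilon> f' D"
      "\<And>D. D \<in> L' \<Longrightarrow> \<exists>Q\<in>N. D = affine_div I Q P"
    show "real (card L') \<le> d"
    proof (rule nb[OF P L'(1,2,3)])
      fix D assume "D \<in> L'"
      then obtain Q where Q: "Q \<in> L" "Q \<noteq> P" "2 ^ card I < 4 * card {X. X \<subseteq> I \<and> P X = Q X}"
        "D = affine_div I Q P" using L'(4) by (auto simp: N_def)
      then show "\<exists>Q\<in>L. D = affine_div I Q P" by blast
      have "\<exists>X\<subseteq>I. Q X \<noteq> P X" using affine_eqI[OF aff[OF Q(1)] aff[OF P]] Q(2) by blast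
      then show "\<exists>X\<subseteq>I. D X \<noteq> \<one>" using affine_div_eq_one_iff[OF aff[OF Q(1)] aff[OF P]] Q(4) by auto
      have "{X. X \<subseteq> I \<and> D X = \<one>} = {X. X \<subseteq> I \<and> P X = Q X}"
        using affine_div_eq_one_iff[OF aff[OF Q(1)] aff[OF P]] Q(4) by auto
      then show "2 ^ card I < 4 * card {X. X \<subseteq> I \<and> D X = \<one>}" using Q(3) by simp
    qed
  qed (use assms(1,3,4) aff[OF P] close in \<open>auto simp: N_def\<close>)
  then show "real (card {Q \<in> L. Q \<noteq> P \<and> 2 ^ card I < 4 * card {X. X \<subseteq> I \<and> P X = Q X}}) \<le> d"
    by (simp add: N_def)
qed

text \<open>The Johnson count is used twice, which explains the nested factors of
  \<open>exponent_bound\<close>: once for \<open>L\<close>, and once for the translated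
  neighbourhood \<open>L'\<close>. A neighbour \<open>E\<close> of \<open>D\<close> within
  \<open>L'\<close> either has all values in \<open>cyc v\<close>, a case for
  \<open>list_cyclic\<close>, or has an independent direction and falls under
  \<open>list_graph\<close>.\<close>

lemma list_exponent:
  fixes \<epsilon> :: real and e :: nat and L :: "('i set \<Rightarrow> 'a) set"
  assumes "finite I" "0 < \<epsilon>" "finite L" "L \<subseteq> affine_on I" and e: "e = 2 \<or> e = 3"
    and expo: "\<And>P X. P \<in> L \<Longrightarrow> X \<subseteq> I \<Longrightarrow> P X [^] e = \<one>"
    and close: "\<And>P. P \<in> L \<Longrightarrow> close_on I \<epsilon> f P"
  shows "real (card L) \<le> exponent_bound (1 / \<epsilon>)"
  unfolding exponent_bound_def
proof (rule neighbours_translate[OF assms(1-4) _ close])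
  define c where "c = cyclic_bound (1 / \<epsilon>)"
  have c: "0 \<le> c" using assms(2) bounds_nonneg(1) by (simp add: c_def)
  then show "0 \<le> 1 / \<epsilon> * (1 + (cyclic_bound (1 / \<epsilon>) + 1 / \<epsilon>))"
    using assms(2) by (simp add: c_def)
  fix P L' f' assume P: "P \<in> L" and L': "finite L'" "L' \<subseteq> affine_on I"
    "\<And>D. D \<in> L' \<Longrightarrow> close_on I \<epsilon> f' D" "\<And>D. D \<in> L' \<Longrightarrow> \<exists>X\<subseteq>I. D X \<noteq> \<one>"
    "\<And>D. D \<in> L' \<Longrightarrow> 2 ^ card I < 4 * card {X. X \<subseteq> I \<and> D X = \<one>}"
    "\<And>D. D \<in> L' \<Longrightarrow> \<exists>Q\<in>L. D = affine_div I Q P"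
  have expo': "D X [^] e = \<one>" if D: "D \<in> L'" "X \<subseteq> I" for D X
  proof -
    obtain Q where Q: "Q \<in> L" "D = affine_div I Q P" using L'(6) D by blast
    have "Q X \<in> carrier G" "P X \<in> carrier G" using affine_closed Q P D assms(4) by blast+
    then show ?thesis
      using Q D expo[OF P D(2)] expo[OF Q(1) D(2)] by (simp add: affine_div_apply nat_pow_distrib nat_pow_inv)
  qed
  have slope_e: "slope D i [^] e = \<one>" if "D \<in> L'" "i \<in> I" for D i
  proof -
    have "D {} \<in> carrier G" "D {i} \<in> carrier G" using affine_closed[of D I] that L'(2) by auto
    then show ?thesis
      using expo'[OF that(1), of "{}"] expo'[OF that(1), of "{i}"] that(2)
      by (simp add: slope_def nat_pow_distrib nat_pow_inv)
  qed
  show "real (card L') \<le> 1 / \<epsilon> * (1 + (cyclic_bound (1 / \<epsilon>) + 1 / \<epsilon>))"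
    unfolding c_def[symmetric]
  proof (rule list_johnson[OF assms(1,2) L'(1) _ L'(3)])
    show "0 \<le> c + 1 / \<epsilon>" using c assms(2) by simp
    fix D assume D: "D \<in> L'"
    have Da: "D \<in> affine_on I" using D L' by blast
    obtain v i X0 where v: "v \<in> carrier G" "v \<noteq> \<one>" "\<And>i. i \<in> I \<Longrightarrow> slope D i \<in> cyc v"
      "i \<in> I" "slope D i = v" "X0 \<subseteq> I" "D X0 = \<one>"
      using neighbour_slopes[OF Da assms(1) L'(4)[OF D] L'(5)[OF D]] by metis
    have ve: "v [^] e = \<one>" using slope_e[OF D v(4)] v by simp
    then have ve': "v [^] (2::nat) = \<one> \<or> v [^] (3::nat) = \<one>" using e by auto
    define N where "N = {E \<in> L'. E \<noteq> D \<and> 2 ^ card I < 4 * card {X. X \<subseteq> I \<and> D X = E X}}"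
    define N1 where "N1 = {E \<in> N. \<forall>X\<subseteq>I. E X \<in> cyc v}"
    define N2 where "N2 = N - N1"
    have fin: "finite N1" "finite N2" using L'(1) by (auto simp: N1_def N2_def N_def)
    have "real (card N1) \<le> c"
      unfolding c_def using L' by (intro list_cyclic[OF assms(1,2) fin(1) _ v(1) ve', where f = f']) (auto simp: N1_def N_def)
    moreover have "real (card N2) \<le> 1 / \<epsilon>"
    proof (rule list_graph[OF assms(1,2) fin(2) Da L'(4)[OF D], where v = v and f = f'])
      fix E assume E: "E \<in> N2"
      then have EL: "E \<in> L'" and agree: "2 ^ card I < 4 * card {X. X \<subseteq> I \<and> D X = E X}"
        by (auto simp: N2_def N_def)
      have Ea: "E \<in> affine_on I" using EL L' by blast
      obtain w j X1 where w: "w \<in> carrier G" "w \<noteq> \<one>" "\<And>i. i \<in> I \<Longrightarrow> slope E i \<in> cyc w"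
        "j \<in> I" "slope E j = w" "X1 \<subseteq> I" "E X1 = \<one>"
        using neighbour_slopes[OF Ea assms(1) L'(4)[OF EL] L'(5)[OF EL]] by metis
      have we: "w [^] e = \<one>" using slope_e[OF EL w(4)] w by simp
      \<comment> \<open>Otherwise all slopes of \<open>E\<close> and its value at the anchor
        \<open>X1\<close> lie in \<open>cyc v\<close>, which would place \<open>E\<close> in
        \<open>N1\<close>.\<close>
      have "w \<notin> cyc v"
      proof
        assume "w \<in> cyc v"
        then have cw: "cyc w = cyc v" using cyc_swap[OF v(1) _ w(2)] by blast
        have "E X \<in> cyc v" if "X \<subseteq> I" for X
          by (rule affine_propagate[OF Ea assms(1) w(6) _ that])
            (use w cw cyc_closed[OF v(1) ve'] cyc_carrier[OF v(1)] in \<open>auto simp: cyc_def\<close>)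
        then show False using E by (auto simp: N2_def N1_def)
      qed
      then show "\<exists>w\<in>carrier G. (v = inv v \<longrightarrow> w = inv w) \<and>
          (\<forall>X\<subseteq>I. (D X, E X) \<in> {(\<one>, \<one>), (v, w), (inv v, inv w)})"
        by (intro neighbour_graph[OF Da Ea assms(1) e v(1,2) ve w(1,2) we v(3) w(3) v(4,5) w(4-5) v(6,7) w(6,7) agree])
    qed (use v L' in \<open>auto simp: N2_def N_def\<close>)
    moreover have "N = N1 \<union> N2" by (auto simp: N1_def N2_def)
    then have "card N \<le> card N1 + card N2" by (metis card_Un_le)
    ultimately have "real (card N) \<le> c + 1 / \<epsilon>" by linarith
    then show "real (card {E \<in> L'. E \<noteq> D \<and> 2 ^ card I < 4 * card {X. X \<subseteq> I \<and> D X = E X}}) \<le> c + 1 / \<epsilon>"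
      by (simp add: N_def)
  qed
qed

text \<open>The squares of the members have exponent two and stay close to the square of
  \<open>f\<close>. Two members with the same square have a quotient of exponent two, so each fibre
  of squaring is translated and bounded in the same way.\<close>

lemma list_exponent_four:
  fixes \<epsilon> :: real and L :: "('i set \<Rightarrow> 'a) set"
  assumes "finite I" "0 < \<epsilon>" "finite L" "L \<subseteq> affine_on I"
    and expo: "\<And>P X. P \<in> L \<Longrightarrow> X \<subseteq> I \<Longrightarrow> P X [^] (4::nat) = \<one>"
    and close: "\<And>P. P \<in> L \<Longrightarrow> close_on I \<epsilon> f P"
  shows "real (card L) \<le> exponent_bound (1 / \<epsilon>) * exponent_bound (1 / \<epsilon>)"
proof -
  define b where "b = exponent_bound (1 / \<epsilon>)"
  have b: "0 \<le> b" using assms(2) bounds_nonneg(2) by (simp add: b_def)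
  have cl: "P X \<in> carrier G" if "P \<in> L" "X \<subseteq> I" for P X using affine_closed that assms(4) by blast
  have img: "real (card (affine_pow I 2 ` L)) \<le> b"
    unfolding b_def
  proof (rule list_exponent[OF assms(1,2), where e = 2 and f = "\<lambda>X. f X [^] (2::nat)"])
    show "affine_pow I 2 ` L \<subseteq> affine_on I" using affine_pow assms(4) by blast
    fix T assume "T \<in> affine_pow I 2 ` L"
    then obtain P where P: "P \<in> L" "T = affine_pow I 2 P" by blast
    show "T X [^] (2::nat) = \<one>" if "X \<subseteq> I" for X
      using expo[OF P(1) that] cl[OF P(1) that] P(2) that by (simp add: affine_pow_def nat_pow_pow)
    have "card {X. X \<subseteq> I \<and> f X = P X} \<le> card {X. X \<subseteq> I \<and> f X [^] (2::nat) = T X}"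
      using assms(1) P(2) by (intro card_mono) (auto simp: affine_pow_def)
    then show "close_on I \<epsilon> (\<lambda>X. f X [^] (2::nat)) T" using close[OF P(1)] by (simp add: close_on_def)
  qed (use assms in auto)
  have fib: "real (card {Q \<in> L. affine_pow I 2 Q = T}) \<le> b" if T: "T \<in> affine_pow I 2 ` L" for T
  proof -
    obtain P where P: "P \<in> L" "T = affine_pow I 2 P" using T by blast
    show ?thesis
    proof (rule card_le_by_translation[where P = P and f = f])
      fix L' f' assume L': "finite L'" "L' \<subseteq> affine_on I" "\<And>D. D \<in> L' \<Longrightarrow> close_on I \<epsilon> f' D"
        "\<And>D. D \<in> L' \<Longrightarrow> \<exists>Q\<in>{Q \<in> L. affine_pow I 2 Q = T}. D = affine_div I Q P"
      show "real (card L') \<le> b" unfolding b_def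
      proof (rule list_exponent[OF assms(1,2) L'(1,2), where e = 2, OF _ _ L'(3)])
        fix D X assume D: "D \<in> L'" "X \<subseteq> I"
        then obtain Q where Q: "Q \<in> L" "affine_pow I 2 Q = affine_pow I 2 P" "D = affine_div I Q P"
          using L'(4) P(2) by blast
        have "Q X [^] (2::nat) = P X [^] (2::nat)"
          using fun_cong[OF Q(2), of X] D(2) by (simp add: affine_pow_def)
        then show "D X [^] (2::nat) = \<one>"
          using cl[OF Q(1) D(2)] cl[OF P(1) D(2)] Q(3) D(2)
          by (simp add: affine_div_apply nat_pow_distrib nat_pow_inv)
      qed simp
    qed (use assms P close in auto)
  qed
  have "L = (\<Union>T\<in>affine_pow I 2 ` L. {Q \<in> L. affine_pow I 2 Q = T})" by blast
  then have "card L \<le> (\<Sum>T\<in>affine_pow I 2 ` L. card {Q \<in> L. affine_pow I 2 Q = T})"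
    using card_UN_le[of "affine_pow I 2 ` L" "\<lambda>T. {Q \<in> L. affine_pow I 2 Q = T}"] assms(3) by simp
  then have "real (card L) \<le> (\<Sum>T\<in>affine_pow I 2 ` L. real (card {Q \<in> L. affine_pow I 2 Q = T}))"
    by (simp only: of_nat_sum[symmetric] of_nat_le_iff)
  also have "\<dots> \<le> real (card (affine_pow I 2 ` L)) * b" using fib by (rule sum_bounded_above)
  also have "\<dots> \<le> b * b" using img b by (rule mult_right_mono)
  finally show ?thesis by (simp add: b_def)
qed

text \<open>The elements whose \<open>k\<close>-th power is one form a subgroup, which contains all
  slopes and the value at \<open>X0\<close>.\<close>

lemma affine_pow_eq_one:
  fixes k :: nat
  assumes D: "D \<in> affine_on I" "finite I" and v: "v \<in> carrier G" "v [^] k = \<one>"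
    and slopes: "\<And>i. i \<in> I \<Longrightarrow> slope D i \<in> cyc v" and "X0 \<subseteq> I" "D X0 = \<one>" "X \<subseteq> I"
  shows "D X [^] k = \<one>"
proof -
  have "D X \<in> {g \<in> carrier G. g [^] k = \<one>}"
  proof (rule affine_propagate[OF D \<open>X0 \<subseteq> I\<close> _ \<open>X \<subseteq> I\<close>])
    fix i assume "i \<in> I"
    then show "slope D i \<in> {g \<in> carrier G. g [^] k = \<one>}"
      using slopes[of i] v by (auto simp: cyc_def nat_pow_inv)
  qed (use assms in \<open>auto simp: nat_pow_distrib nat_pow_inv\<close>)
  then show ?thesis by simp
qed

text \<open>The neighbours of the trivial function are sorted by the order of their slope
  \<open>v\<close> into sparse ones and those of exponent three or four; the three summands of
  \<open>list_bound\<close> inside the Johnson factor correspond to these classes.\<close>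

lemma list_affine:
  fixes \<epsilon> :: real and L :: "('i set \<Rightarrow> 'a) set"
  assumes "finite I" "0 < \<epsilon>" "finite L" "L \<subseteq> affine_on I"
    and close: "\<And>P. P \<in> L \<Longrightarrow> close_on I \<epsilon> f P"
  shows "real (card L) \<le> list_bound (1 / \<epsilon>)"
  unfolding list_bound_def
proof (rule neighbours_translate[OF assms(1-4) _ close])
  define s where "s = sparse_bound 16 16 (1 / \<epsilon>)"
  define b where "b = exponent_bound (1 / \<epsilon>)"
  show "0 \<le> sparse_bound 16 16 (1 / \<epsilon>) + exponent_bound (1 / \<epsilon>) + exponent_bound (1 / \<epsilon>) * exponent_bound (1 / \<epsilon>)"
    using assms(2) by (intro add_nonneg_nonneg mult_nonneg_nonneg bounds_nonneg sparse_bound_nonneg) auto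
  fix P L' f' assume L': "finite L'" "L' \<subseteq> affine_on I"
    "\<And>D. D \<in> L' \<Longrightarrow> close_on I \<epsilon> f' D" "\<And>D. D \<in> L' \<Longrightarrow> \<exists>X\<subseteq>I. D X \<noteq> \<one>"
    "\<And>D. D \<in> L' \<Longrightarrow> 2 ^ card I < 4 * card {X. X \<subseteq> I \<and> D X = \<one>}"
  define N1 where "N1 = {D \<in> L'. card (support I D) \<le> 16}"
  define N2 where "N2 = {D \<in> L'. \<forall>X\<subseteq>I. D X [^] (3::nat) = \<one>}"
  define N3 where "N3 = {D \<in> L'. \<forall>X\<subseteq>I. D X [^] (4::nat) = \<one>}"
  have c1: "real (card N1) \<le> s"
    unfolding s_def using L' by (intro list_sparse[OF assms(1,2), of _ _ f']) (auto simp: N1_def)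
  have c2: "real (card N2) \<le> b"
    unfolding b_def using L' by (intro list_exponent[OF assms(1,2), of _ 3 f']) (auto simp: N2_def)
  have c3: "real (card N3) \<le> b * b"
    unfolding b_def using L' by (intro list_exponent_four[OF assms(1,2), of _ f']) (auto simp: N3_def)
  have "L' \<subseteq> N1 \<union> N2 \<union> N3"
  proof
    fix D assume D: "D \<in> L'"
    have Da: "D \<in> affine_on I" using D L' by blast
    obtain v i X0 where v: "v \<in> carrier G" "v \<noteq> \<one>" "\<And>i. i \<in> I \<Longrightarrow> slope D i \<in> cyc v"
      "X0 \<subseteq> I" "D X0 = \<one>"
      using neighbour_slopes[OF Da assms(1) L'(4)[OF D] L'(5)[OF D]] by metis
    \<comment> \<open>Order two is included in the second case, so in the third no power of
      \<open>v\<close> from the first to the fourth is one.\<close>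
    consider "v [^] (3::nat) = \<one>" | "v [^] (4::nat) = \<one>"
      | "v [^] (3::nat) \<noteq> \<one>" "v [^] (4::nat) \<noteq> \<one>" by blast
    then show "D \<in> N1 \<union> N2 \<union> N3"
    proof cases
      case 1
      then have "D \<in> N2" using D affine_pow_eq_one[OF Da assms(1) v(1) _ v(3-5)] by (simp add: N2_def)
      then show ?thesis by simp
    next
      case 2
      then have "D \<in> N3" using D affine_pow_eq_one[OF Da assms(1) v(1) _ v(3-5)] by (simp add: N3_def)
      then show ?thesis by simp
    next
      case 3
      have "v [^] (2::nat) \<noteq> \<one>"
      proof
        assume "v [^] (2::nat) = \<one>"
        then show False using 3 nat_pow_pow[OF v(1), of 2 2] by simp
      qed
      then have small: "v [^] k \<noteq> \<one>" if "1 \<le> k" "k < 5" for k :: nat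
      proof -
        have "k \<in> {1, 2, 3, 4}" using that by auto
        then show ?thesis using 3 \<open>v [^] (2::nat) \<noteq> \<one>\<close> v by auto
      qed
      have "card (support I D) \<le> 2 * 8"
      \<comment> \<open>With \<open>m = 8\<close> the bound 128 out of \<open>2 ^ 9\<close> is
        exactly the quarter that a neighbour exceeds.\<close>
      proof (rule support_card_le[OF Da assms(1) v(1), where q = 5 and c = 128])
        show "(\<Sum>j\<le>Suc 8. of_bool (b j) * (Suc 8 choose j)) \<le> 128"
          if "\<And>j k. b j \<Longrightarrow> b k \<Longrightarrow> j < k \<Longrightarrow> j + 5 \<le> k" for b
          using binomial_9_gap_5[of b] that by simp
        show "128 * 2 ^ card I < 2 ^ Suc 8 * card {X. X \<subseteq> I \<and> D X = \<one>}"
          using L'(5)[OF D] by simp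
      qed (use v(3) small in \<open>auto simp: cyc_def\<close>)
      then show ?thesis using D by (simp add: N1_def)
    qed
  qed
  then have "card L' \<le> card (N1 \<union> N2 \<union> N3)"
    using L'(1) by (intro card_mono) (auto simp: N1_def N2_def N3_def)
  also have "\<dots> \<le> card N1 + card N2 + card N3"
    by (meson add_le_mono1 card_Un_le order_trans)
  finally have "real (card L') \<le> real (card N1) + real (card N2) + real (card N3)" by simp
  then show "real (card L') \<le> sparse_bound 16 16 (1 / \<epsilon>) + exponent_bound (1 / \<epsilon>) + exponent_bound (1 / \<epsilon>) * exponent_bound (1 / \<epsilon>)"
    using c1 c2 c3 unfolding s_def b_def by linarith
qed

end

section \<open>The bound is a polynomial in \<open>1 / \<epsilon>\<close>\<close>

lemma sparse_bound_poly: "\<exists>p. \<forall>x. poly p x = sparse_bound k r x"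
proof (induction r)
  case 0
  show ?case by (rule exI[of _ "[:0, 2 ^ (2 ^ k):]"]) simp
next
  case (Suc r)
  then obtain p where "\<forall>x. poly p x = sparse_bound k r x" by blast
  then show ?case
    by (intro exI[of _ "[:0, 2 ^ (2 ^ k):] + [:0, 0, real k:] * p"]) (simp add: power2_eq_square algebra_simps)
qed

lemma list_bound_poly: "\<exists>p. \<forall>x. poly p x = list_bound x"
proof -
  obtain p q where p: "\<And>x. poly p x = sparse_bound 6 6 x" and q: "\<And>x. poly q x = sparse_bound 16 16 x"
    using sparse_bound_poly by metis
  define X where "X = [:0, 1:: real:]"
  define c where "c = X\<^sup>2 + 2 * X * (1 + p)"
  define e where "e = X * (1 + X * (1 + (c + X)))"
  have "poly (X * (1 + (q + e + e * e))) x = list_bound x" for x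
  proof -
    have "poly c x = cyclic_bound x" by (simp add: cyclic_bound_def c_def X_def p algebra_simps)
    then have "poly e x = exponent_bound x" by (simp add: exponent_bound_def e_def X_def)
    then show ?thesis by (simp add: list_bound_def X_def q)
  qed
  then show ?thesis by blast
qed

section \<open>Transfer to the cube and to arbitrary carrier types\<close>

text \<open>The indicator vector of \<open>X\<close>, restricted to \<open>{1..n}\<close> so that it
  is extensional like the members of \<open>cube n\<close>.\<close>

definition vertex :: "nat \<Rightarrow> nat set \<Rightarrow> nat \<Rightarrow> int" where
  "vertex n X = (\<lambda>i\<in>{1..n}. of_bool (i \<in> X))"

lemma bij_betw_vertex: "bij_betw (vertex n) (Pow {1..n}) (cube n)"
proof (rule bij_betw_byWitness[where f' = "\<lambda>x. {i \<in> {1..n}. x i = 1}"])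
  show "\<forall>x\<in>cube n. vertex n {i \<in> {1..n}. x i = 1} = x"
  proof
    fix x assume x: "x \<in> cube n"
    show "vertex n {i \<in> {1..n}. x i = 1} = x"
    proof
      fix i
      show "vertex n {i \<in> {1..n}. x i = 1} i = x i"
        using x PiE_mem[of x "{1..n}" "\<lambda>_. {0, 1}" i] PiE_arb[of x "{1..n}" "\<lambda>_. {0, 1}" i]
        by (cases "i \<in> {1..n}") (auto simp: vertex_def cube_def)
    qed
  qed
qed (auto simp: vertex_def cube_def)

lemma vertex_in_cube: "X \<subseteq> {1..n} \<Longrightarrow> vertex n X \<in> cube n"
  using bij_betw_vertex[of n] by (auto simp: bij_betw_def)

lemma cube_vertexE:
  assumes "x \<in> cube n"
  obtains X where "X \<subseteq> {1..n}" "x = vertex n X"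
proof -
  have "x \<in> vertex n ` Pow {1..n}" using assms bij_betw_imp_surj_on[OF bij_betw_vertex, of n] by simp
  then show ?thesis using that by blast
qed

lemma finite_cube: "finite (cube n)" and card_cube: "card (cube n) = 2 ^ n"
  using bij_betw_finite[OF bij_betw_vertex, of n] bij_betw_same_card[OF bij_betw_vertex, of n]
  by (auto simp: card_Pow)

lemma cube_nonempty: "cube n \<noteq> {}"
  using card_cube[of n] by auto

lemma rel_dist_cube: "rel_dist (cube n) f P = real (card {x \<in> cube n. f x \<noteq> P x}) / 2 ^ n"
  by (simp add: rel_dist_def measure_pmf_of_set[OF cube_nonempty finite_cube] card_cube Int_def)

lemma close_on_vertex:
  assumes "rel_dist (cube n) f P \<le> 1/2 - \<epsilon>"
  shows "close_on {1..n} \<epsilon> (\<lambda>X. f (vertex n X)) (\<lambda>X\<in>Pow {1..n}. P (vertex n X))"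
proof -
  have "bij_betw (vertex n) {X \<in> Pow {1..n}. f (vertex n X) = P (vertex n X)} {x \<in> cube n. f x = P x}"
  proof (rule bij_betw_subset[OF bij_betw_vertex])
    show "vertex n ` {X \<in> Pow {1..n}. f (vertex n X) = P (vertex n X)} = {x \<in> cube n. f x = P x}"
    proof (intro equalityI subsetI)
      fix x assume x: "x \<in> {x \<in> cube n. f x = P x}"
      then obtain X where "X \<subseteq> {1..n}" "x = vertex n X" using cube_vertexE[of x n] by blast
      then show "x \<in> vertex n ` {X \<in> Pow {1..n}. f (vertex n X) = P (vertex n X)}" using x by simp
    qed (auto simp: vertex_in_cube)
  qed auto
  then have "card {X \<in> Pow {1..n}. f (vertex n X) = P (vertex n X)} = card {x \<in> cube n. f x = P x}"
    by (rule bij_betw_same_card)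
  moreover have "{X. X \<subseteq> {1..n} \<and> f (vertex n X) = (\<lambda>X\<in>Pow {1..n}. P (vertex n X)) X}
      = {X \<in> Pow {1..n}. f (vertex n X) = P (vertex n X)}" by auto
  moreover have "card {x \<in> cube n. f x = P x} + card {x \<in> cube n. f x \<noteq> P x} = 2 ^ n"
  proof -
    have "cube n = {x \<in> cube n. f x = P x} \<union> {x \<in> cube n. f x \<noteq> P x}" by blast
    then have "card (cube n) = card {x \<in> cube n. f x = P x} + card {x \<in> cube n. f x \<noteq> P x}"
      using finite_cube by (subst card_Un_disjoint[symmetric]) auto
    then show ?thesis by (simp add: card_cube)
  qed
  then have "real (card {x \<in> cube n. f x = P x}) + real (card {x \<in> cube n. f x \<noteq> P x}) = 2 ^ n"
    unfolding of_nat_add[symmetric] by simp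
  moreover have "real (card {x \<in> cube n. f x \<noteq> P x}) \<le> (1/2 - \<epsilon>) * 2 ^ n"
    using assms by (simp add: rel_dist_cube divide_le_eq)
  ultimately show ?thesis by (simp add: close_on_def algebra_simps)
qed

section \<open>Linear polynomials as affine functions\<close>

context comm_group
begin

text \<open>Adding \<open>i\<close> to \<open>X\<close> changes only the \<open>i\<close>-th factor,
  from one to \<open>a i\<close>, so the coefficients are the slopes.\<close>

lemma linear_poly_affine:
  assumes "P \<in> linear_polys n G"
  shows "(\<lambda>X\<in>Pow {1..n}. P (vertex n X)) \<in> affine_on {1..n}"
proof -
  obtain a where a: "a \<in> {0..n} \<rightarrow> carrier G"
    and P: "P = restrict (\<lambda>x. a 0 \<otimes> finprod G (\<lambda>i. a i [^] x i) {1..n}) (cube n)"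
    using assms unfolding linear_polys_def by blast
  define t where "t X = (\<lambda>i. a i [^] vertex n X i)" for X
  have t: "t X \<in> A \<rightarrow> carrier G" if "A \<subseteq> {1..n}" for X A
  proof
    fix i assume "i \<in> A"
    then have "i \<in> {0..n}" using that by auto
    then have "a i \<in> carrier G" using a by blast
    then show "t X i \<in> carrier G" by (simp add: t_def)
  qed
  have a0: "a 0 \<in> carrier G" using a by auto
  have PX: "P (vertex n X) = a 0 \<otimes> finprod G (t X) {1..n}" if "X \<subseteq> {1..n}" for X
    using vertex_in_cube[OF that] by (simp add: P t_def)
  show ?thesis
  proof (rule affine_onI(1)[where a = a])
    show "(\<lambda>X\<in>Pow {1..n}. P (vertex n X)) \<in> Pow {1..n} \<rightarrow>\<^sub>E carrier G"
      using PX a0 finprod_closed[OF t] by auto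
    show "a i \<in> carrier G" if "i \<in> {1..n}" for i using a that by auto
    fix X i assume X: "X \<subseteq> {1..n}" "i \<in> {1..n}" "i \<notin> X"
    define A where "A = {1..n} - {i}"
    have A: "{1..n} = insert i A" "finite A" "i \<notin> A" "A \<subseteq> {1..n}" using X by (auto simp: A_def)
    have ai: "a i \<in> carrier G" using a X by auto
    have "finprod G (t (insert i X)) A = finprod G (t X) A"
      using t[OF A(4)] by (intro finprod_cong') (auto simp: t_def vertex_def A_def)
    moreover have "finprod G (t Y) {1..n} = t Y i \<otimes> finprod G (t Y) A" for Y
      using finprod_insert[OF A(2,3) t[OF A(4), of Y]] Pi_mem[OF t[OF order_refl] X(2), of Y]
      unfolding A(1)[symmetric] by blast
    moreover have "t (insert i X) i = a i" "t X i = \<one>"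
      using X ai by (simp_all add: t_def vertex_def)
    ultimately show "(\<lambda>X\<in>Pow {1..n}. P (vertex n X)) (insert i X) = (\<lambda>X\<in>Pow {1..n}. P (vertex n X)) X \<otimes> a i"
      using X PX[of X] PX[of "insert i X"] a0 ai finprod_closed[OF t[OF A(4)], of X] by (simp add: m_ac)
  qed
qed

lemma linear_polys_vertex_inj: "inj_on (\<lambda>P. \<lambda>X\<in>Pow {1..n}. P (vertex n X)) (linear_polys n G)"
proof (rule inj_onI)
  fix P Q assume PQ: "P \<in> linear_polys n G" "Q \<in> linear_polys n G"
    and eq: "(\<lambda>X\<in>Pow {1..n}. P (vertex n X)) = (\<lambda>X\<in>Pow {1..n}. Q (vertex n X))"
  have "P x = Q x" if x: "x \<in> cube n" for x
  proof -
    obtain X where X: "X \<subseteq> {1..n}" "x = vertex n X" using cube_vertexE[OF x] by blast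
    then show ?thesis using fun_cong[OF eq, of X] by simp
  qed
  moreover have "P \<in> extensional (cube n)" "Q \<in> extensional (cube n)"
    using PQ by (auto simp: linear_polys_def)
  ultimately show "P = Q" by (rule extensionalityI[rotated 2])
qed

lemma linear_polys_list_decodable:
  assumes "0 < \<epsilon>"
  shows "list_decodable (cube n) (carrier G) (linear_polys n G) (1/2 - \<epsilon>) (list_bound (1 / \<epsilon>))"
  unfolding list_decodable_def
proof (rule ballI)
  fix f
  define F where "F = {P \<in> linear_polys n G. rel_dist (cube n) f P \<le> 1/2 - \<epsilon>}"
  \<comment> \<open>Finiteness of \<open>F\<close> is part of the claim and not automatic for
    infinite groups. The bound is first shown for finite sublists; an infinite \<open>F\<close>
    would contain one that is too long.\<close>
  have le: "real (card L) \<le> list_bound (1 / \<epsilon>)" if L: "L \<subseteq> F" "finite L" for L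
  proof -
    define L' where "L' = (\<lambda>P. \<lambda>X\<in>Pow {1..n}. P (vertex n X)) ` L"
    have "inj_on (\<lambda>P. \<lambda>X\<in>Pow {1..n}. P (vertex n X)) L"
      by (rule inj_on_subset[OF linear_polys_vertex_inj]) (use L in \<open>auto simp: F_def\<close>)
    then have "card L' = card L" unfolding L'_def by (rule card_image)
    moreover have "real (card L') \<le> list_bound (1 / \<epsilon>)"
    proof (rule list_affine[OF _ assms, where I = "{1..n}" and f = "\<lambda>X. f (vertex n X)"])
      show "L' \<subseteq> affine_on {1..n}" using L linear_poly_affine by (auto simp: L'_def F_def)
      show "close_on {1..n} \<epsilon> (\<lambda>X. f (vertex n X)) P" if P: "P \<in> L'" for P
      proof -
        obtain Q where Q: "Q \<in> L" "P = (\<lambda>X\<in>Pow {1..n}. Q (vertex n X))" using P by (auto simp: L'_def)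
        then show ?thesis using close_on_vertex[of n f Q \<epsilon>] L by (auto simp: F_def)
      qed
    qed (use L in \<open>auto simp: L'_def\<close>)
    ultimately show ?thesis by simp
  qed
  have "finite F"
  proof (rule ccontr)
    assume "infinite F"
    then obtain L where L: "finite L" "card L = Suc (nat \<lceil>list_bound (1 / \<epsilon>)\<rceil>)" "L \<subseteq> F"
      using infinite_arbitrarily_large by blast
    then show False using le[OF L(3,1)] by linarith
  qed
  then show "finite {P \<in> linear_polys n G. rel_dist (cube n) f P \<le> 1/2 - \<epsilon>} \<and>
      real (card {P \<in> linear_polys n G. rel_dist (cube n) f P \<le> 1/2 - \<epsilon>}) \<le> list_bound (1 / \<epsilon>)"
    using le[of F] by (simp add: F_def)
qed

end

text \<open>The polynomial for \<open>list_bound\<close> witnesses the existential behind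
  \<open>SOME\<close>. The chosen \<open>list_size_poly\<close> may be a different polynomial; only
  its defining property for groups on the naturals is available.\<close>

lemma list_size_poly_nat:
  fixes G :: "nat monoid"
  assumes "0 < \<epsilon>" "comm_group G" "1 \<le> n"
  shows "list_decodable (cube n) (carrier G) (linear_polys n G) (1/2 - \<epsilon>) (poly list_size_poly (1 / \<epsilon>))"
proof -
  obtain p where p: "\<And>x. poly p x = list_bound x" using list_bound_poly by blast
  have "\<exists>p. \<forall>\<epsilon>>0. \<forall>G :: nat monoid. comm_group G \<longrightarrow> (\<forall>n\<ge>1.
      list_decodable (cube n) (carrier G) (linear_polys n G) (1/2 - \<epsilon>) (poly p (1/\<epsilon>)))"
    by (rule exI[of _ p], unfold p) (intro allI impI comm_group.linear_polys_list_decodable)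
  from someI_ex[OF this, folded list_size_poly_def] show ?thesis using assms by blast
qed

section \<open>Countable subgroups and their copies on the naturals\<close>

context group
begin

text \<open>Every generated element is the product of a finite list over \<open>A\<close> and the
  inverses of its elements, and there are countably many such lists.\<close>

lemma countable_generate:
  assumes "countable A" "A \<subseteq> carrier G"
  shows "countable (generate G A)"
proof -
  define B where "B = A \<union> m_inv G ` A"
  define pr where "pr l = foldr (\<otimes>) l \<one>" for l
  have B: "B \<subseteq> carrier G" "countable B" using assms by (auto simp: B_def)
  have pr_closed: "pr l \<in> carrier G" if "l \<in> lists B" for l
    using that B(1) by (induction l) (auto simp: pr_def)
  have pr_append: "pr (l @ l') = pr l \<otimes> pr l'" if "l \<in> lists B" "l' \<in> lists B" for l l'
    using that(1)
  proof (induction l)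
    case Nil
    then show ?case using pr_closed[OF that(2)] by (simp add: pr_def)
  next
    case (Cons x l)
    then show ?case using pr_closed[of l] pr_closed[OF that(2)] B(1) by (auto simp: pr_def m_assoc)
  qed
  have "g \<in> pr ` lists B" if "g \<in> generate G A" for g
    using that
  proof induction
    case one
    then show ?case by (intro image_eqI[of _ _ "[]"]) (auto simp: pr_def)
  next
    case (incl h)
    then show ?case using assms(2) by (intro image_eqI[of _ _ "[h]"]) (auto simp: pr_def B_def)
  next
    case (inv h)
    then show ?case using assms(2) by (intro image_eqI[of _ _ "[inv h]"]) (auto simp: pr_def B_def)
  next
    case (eng h1 h2)
    then obtain l1 l2 where "l1 \<in> lists B" "l2 \<in> lists B" "h1 = pr l1" "h2 = pr l2" by blast
    then show ?case using pr_append[of l1 l2] by (intro image_eqI[of _ _ "l1 @ l2"]) auto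
  qed
  then have "generate G A \<subseteq> pr ` lists B" by blast
  then show ?thesis by (rule countable_subset) (intro countable_image countable_lists B(2))
qed

end

text \<open>Since \<open>h\<close> is multiplicative on \<open>H\<close> only, membership of the
  partial products in \<open>H\<close> is carried through the induction.\<close>

lemma finprod_transport:
  assumes G: "comm_group G" and G': "comm_group G'" and H: "subgroup H G"
    and h: "\<And>x. x \<in> H \<Longrightarrow> h x \<in> carrier G'" "h \<one>\<^bsub>G\<^esub> = \<one>\<^bsub>G'\<^esub>"
      "\<And>x y. x \<in> H \<Longrightarrow> y \<in> H \<Longrightarrow> h (x \<otimes>\<^bsub>G\<^esub> y) = h x \<otimes>\<^bsub>G'\<^esub> h y"
    and "finite S" "\<And>i. i \<in> S \<Longrightarrow> t i \<in> H"
  shows "finprod G t S \<in> H \<and> h (finprod G t S) = finprod G' (\<lambda>i. h (t i)) S"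
  using assms(7,8)
proof (induction S)
  case empty
  interpret G: comm_group G by fact
  interpret G': comm_group G' by fact
  show ?case using h subgroup.one_closed[OF H] by simp
next
  case (insert i S)
  interpret G: comm_group G by fact
  interpret G': comm_group G' by fact
  have c: "t j \<in> H" "t j \<in> carrier G" "h (t j) \<in> carrier G'" if "j \<in> insert i S" for j
    using that insert.prems h(1) subgroup.mem_carrier[OF H] by auto
  have "finprod G t (insert i S) = t i \<otimes>\<^bsub>G\<^esub> finprod G t S"
    using insert.hyps c by (intro G.finprod_insert) auto
  moreover have "finprod G' (\<lambda>i. h (t i)) (insert i S) = h (t i) \<otimes>\<^bsub>G'\<^esub> finprod G' (\<lambda>i. h (t i)) S"
    using insert.hyps c by (intro G'.finprod_insert) auto
  ultimately show ?case using insert.IH insert.prems h(3) subgroup.m_closed[OF H] by simp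
qed

lemma linear_poly_transport:
  assumes G: "comm_group G" and G': "comm_group G'" and H: "subgroup H G"
    and h: "\<And>x. x \<in> H \<Longrightarrow> h x \<in> carrier G'" "h \<one>\<^bsub>G\<^esub> = \<one>\<^bsub>G'\<^esub>"
      "\<And>x y. x \<in> H \<Longrightarrow> y \<in> H \<Longrightarrow> h (x \<otimes>\<^bsub>G\<^esub> y) = h x \<otimes>\<^bsub>G'\<^esub> h y"
    and a: "\<And>i. i \<le> n \<Longrightarrow> a i \<in> H"
    and P: "P = restrict (\<lambda>x. a 0 \<otimes>\<^bsub>G\<^esub> finprod G (\<lambda>i. a i [^]\<^bsub>G\<^esub> x i) {1..n}) (cube n)"
  shows "\<And>x. x \<in> cube n \<Longrightarrow> P x \<in> H"
    and "restrict (\<lambda>x. h (P x)) (cube n) \<in> linear_polys n G'"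
proof -
  interpret G: comm_group G by fact
  interpret G': comm_group G' by fact
  have pow: "a i [^]\<^bsub>G\<^esub> x i \<in> H \<and> h (a i [^]\<^bsub>G\<^esub> x i) = h (a i) [^]\<^bsub>G'\<^esub> x i"
    if "x \<in> cube n" "i \<in> {1..n}" for x i
  proof -
    \<comment> \<open>On the cube every exponent is 0 or 1, so preservation of one and of products
      lets the powers pass through \<open>h\<close>.\<close>
    have "x i = 0 \<or> x i = 1" using that by (auto simp: cube_def dest: PiE_mem)
    then show ?thesis
      using h a[of i] that(2) subgroup.one_closed[OF H] subgroup.mem_carrier[OF H, of "a i"] by auto
  qed
  have fp: "finprod G (\<lambda>i. a i [^]\<^bsub>G\<^esub> x i) {1..n} \<in> H \<and>
      h (finprod G (\<lambda>i. a i [^]\<^bsub>G\<^esub> x i) {1..n}) = finprod G' (\<lambda>i. h (a i) [^]\<^bsub>G'\<^esub> x i) {1..n}"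
    if x: "x \<in> cube n" for x
  proof -
    have "finprod G' (\<lambda>i. h (a i [^]\<^bsub>G\<^esub> x i)) {1..n} = finprod G' (\<lambda>i. h (a i) [^]\<^bsub>G'\<^esub> x i) {1..n}"
      using pow[OF x] h(1) a by (intro G'.finprod_cong') auto
    then show ?thesis
      using finprod_transport[OF G G' H h, of "{1..n}" "\<lambda>i. a i [^]\<^bsub>G\<^esub> x i"] pow[OF x] by simp
  qed
  show "P x \<in> H" if "x \<in> cube n" for x
    using that fp[OF that] a[of 0] subgroup.m_closed[OF H] by (simp add: P)
  have "restrict (\<lambda>x. h (P x)) (cube n)
      = restrict (\<lambda>x. h (a 0) \<otimes>\<^bsub>G'\<^esub> finprod G' (\<lambda>i. h (a i) [^]\<^bsub>G'\<^esub> x i) {1..n}) (cube n)"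
    using fp a[of 0] h(3) by (intro restrict_ext) (simp add: P)
  then show "restrict (\<lambda>x. h (P x)) (cube n) \<in> linear_polys n G'"
    unfolding linear_polys_def using h(1) a by (intro CollectI exI[of _ "\<lambda>i. h (a i)"]) auto
qed

text \<open>The group structure of \<open>H\<close> is carried along the injection
  \<open>to_nat_on H\<close>: multiply by decoding with \<open>g\<close>, multiplying in
  \<open>G\<close> and encoding again.\<close>

lemma countable_subgroup_nat_copy:
  fixes G :: "'a monoid"
  assumes "comm_group G" "subgroup H G" "countable H"
  obtains G' :: "nat monoid" and h where "comm_group G'" "carrier G' = h ` H" "inj_on h H"
    "h \<one>\<^bsub>G\<^esub> = \<one>\<^bsub>G'\<^esub>" "\<And>x y. x \<in> H \<Longrightarrow> y \<in> H \<Longrightarrow> h (x \<otimes>\<^bsub>G\<^esub> y) = h x \<otimes>\<^bsub>G'\<^esub> h y"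
proof -
  interpret G: comm_group G by fact
  interpret H: subgroup H G by fact
  define h where "h = to_nat_on H"
  have inj: "inj_on h H" using assms(3) by (simp add: h_def inj_on_to_nat_on)
  define g where "g = inv_into H h"
  define G' where "G' = \<lparr>carrier = h ` H, monoid.mult = (\<lambda>x y. h (g x \<otimes>\<^bsub>G\<^esub> g y)), one = h \<one>\<^bsub>G\<^esub>\<rparr>"
  have gh: "g (h x) = x" if "x \<in> H" for x using that inj by (simp add: g_def)
  have m: "h x \<otimes>\<^bsub>G'\<^esub> h y = h (x \<otimes>\<^bsub>G\<^esub> y)" if "x \<in> H" "y \<in> H" for x y
    using that gh by (simp add: G'_def)
  have car: "carrier G' = h ` H" "\<one>\<^bsub>G'\<^esub> = h \<one>\<^bsub>G\<^esub>" by (simp_all add: G'_def)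
  have mem: "x \<in> carrier G" if "x \<in> H" for x using that H.mem_carrier by blast
  have "comm_group G'"
  proof (rule comm_groupI)
    fix x assume "x \<in> carrier G'"
    then obtain u where u: "u \<in> H" "x = h u" by (auto simp: car)
    show "\<exists>y\<in>carrier G'. y \<otimes>\<^bsub>G'\<^esub> x = \<one>\<^bsub>G'\<^esub>"
      using u m[of "inv\<^bsub>G\<^esub> u" u] mem by (intro bexI[of _ "h (inv\<^bsub>G\<^esub> u)"]) (auto simp: car)
    show "\<one>\<^bsub>G'\<^esub> \<otimes>\<^bsub>G'\<^esub> x = x" using u m[of "\<one>\<^bsub>G\<^esub>" u] mem by (simp add: car)
  next
    fix x y assume "x \<in> carrier G'" "y \<in> carrier G'"
    then obtain u v where u: "u \<in> H" "x = h u" "v \<in> H" "y = h v" by (auto simp: car)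
    show "x \<otimes>\<^bsub>G'\<^esub> y \<in> carrier G'" using u m by (simp add: car)
    show "x \<otimes>\<^bsub>G'\<^esub> y = y \<otimes>\<^bsub>G'\<^esub> x" using u m mem G.m_comm by simp
  next
    fix x y z assume "x \<in> carrier G'" "y \<in> carrier G'" "z \<in> carrier G'"
    then obtain u v w where u: "u \<in> H" "x = h u" "v \<in> H" "y = h v" "w \<in> H" "z = h w" by (auto simp: car)
    show "x \<otimes>\<^bsub>G'\<^esub> y \<otimes>\<^bsub>G'\<^esub> z = x \<otimes>\<^bsub>G'\<^esub> (y \<otimes>\<^bsub>G'\<^esub> z)"
      using u m mem G.m_assoc by simp
  qed (simp add: car)
  then show ?thesis using that[of G' h] car inj m by simp
qed

text \<open>For \<open>G\<close> itself the bound \<open>list_bound\<close> is known, but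
  \<open>list_size_poly\<close> is only specified on groups of naturals. The list is therefore
  copied injectively, with the same distances, into such a group.\<close>

theorem theorem1p2:
  fixes \<epsilon> :: real and G :: "'a monoid" and n :: nat
  assumes "\<epsilon> > 0" and "comm_group G" and "n \<ge> 1"
  shows "list_decodable (cube n) (carrier G) (linear_polys n G) (1/2 - \<epsilon>)
           (poly list_size_poly (1/\<epsilon>))"
  unfolding list_decodable_def
proof (rule ballI)
  interpret G: comm_group G by fact
  fix f assume f: "f \<in> cube n \<rightarrow> carrier G"
  define F where "F = {P \<in> linear_polys n G. rel_dist (cube n) f P \<le> 1/2 - \<epsilon>}"
  \<comment> \<open>The direct bound for \<open>G\<close> makes the list finite, so that finitely
    many coefficients determine it.\<close>
  have finF: "finite F"
    using G.linear_polys_list_decodable[OF assms(1), of n] f by (simp add: list_decodable_def F_def)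
  define coeffs where "coeffs P b \<longleftrightarrow> b \<in> {0..n} \<rightarrow> carrier G \<and>
      P = restrict (\<lambda>x. b 0 \<otimes>\<^bsub>G\<^esub> finprod G (\<lambda>i. b i [^]\<^bsub>G\<^esub> x i) {1..n}) (cube n)" for P b
  define a where "a P = (SOME b. coeffs P b)" for P
  have "coeffs P (a P)" if "P \<in> F" for P
  proof -
    have "\<exists>b. coeffs P b" using that unfolding coeffs_def F_def linear_polys_def by blast
    then show ?thesis unfolding a_def by (rule someI_ex)
  qed
  then have a: "\<And>P. P \<in> F \<Longrightarrow> a P \<in> {0..n} \<rightarrow> carrier G"
    and P: "\<And>P. P \<in> F \<Longrightarrow> P = restrict (\<lambda>x. a P 0 \<otimes>\<^bsub>G\<^esub> finprod G (\<lambda>i. a P i [^]\<^bsub>G\<^esub> x i) {1..n}) (cube n)"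
    unfolding coeffs_def by blast+
  \<comment> \<open>All group elements that occur in \<open>f\<close> and in the chosen
    coefficients; the finite set generates a countable subgroup.\<close>
  define A where "A = f ` cube n \<union> (\<Union>P\<in>F. a P ` {0..n})"
  have A: "A \<subseteq> carrier G" "finite A" using f a finF finite_cube by (auto simp: A_def)
  define H where "H = generate G A"
  have H: "subgroup H G" "countable H"
    unfolding H_def
    by (rule G.generate_is_subgroup[OF A(1)], rule G.countable_generate[OF countable_finite[OF A(2)] A(1)])
  have inH: "x \<in> H" if "x \<in> A" for x using that by (simp add: H_def generate.incl)
  obtain G' :: "nat monoid" and h where G': "comm_group G'" "carrier G' = h ` H" "inj_on h H"
    "h \<one>\<^bsub>G\<^esub> = \<one>\<^bsub>G'\<^esub>" "\<And>x y. x \<in> H \<Longrightarrow> y \<in> H \<Longrightarrow> h (x \<otimes>\<^bsub>G\<^esub> y) = h x \<otimes>\<^bsub>G'\<^esub> h y"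
    using countable_subgroup_nat_copy[OF assms(2) H] by metis
  have hc: "h x \<in> carrier G'" if "x \<in> H" for x using that G'(2) by simp
  define T where "T P = restrict (\<lambda>x. h (P x)) (cube n)" for P
  have aH: "a P i \<in> H" if "P \<in> F" "i \<le> n" for P i
    using that by (intro inH) (unfold A_def, intro UnI2 UN_I imageI, auto)
  have fH: "f x \<in> H" if "x \<in> cube n" for x using that by (intro inH) (auto simp: A_def)
  have PH: "P x \<in> H" if "P \<in> F" "x \<in> cube n" for P x
    using linear_poly_transport(1)[OF assms(2) G'(1) H(1) hc G'(4,5) aH[OF that(1)] P[OF that(1)] that(2)] .
  have TP: "T P \<in> linear_polys n G'" if "P \<in> F" for P
    unfolding T_def using linear_poly_transport(2)[OF assms(2) G'(1) H(1) hc G'(4,5) aH[OF that] P[OF that]] .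
  define f' where "f' x = h (f x)" for x
  have dist: "rel_dist (cube n) f' (T P) = rel_dist (cube n) f P" if "P \<in> F" for P
  proof -
    \<comment> \<open>Injectivity of \<open>h\<close> on \<open>H\<close> preserves each single
      agreement and disagreement.\<close>
    have "{x \<in> cube n. f' x \<noteq> T P x} = {x \<in> cube n. f x \<noteq> P x}"
      using fH PH[OF that] inj_on_eq_iff[OF G'(3)] by (auto simp: f'_def T_def)
    then show ?thesis by (simp add: rel_dist_cube)
  qed
  define F' where "F' = {Q \<in> linear_polys n G'. rel_dist (cube n) f' Q \<le> 1/2 - \<epsilon>}"
  have F': "finite F'" "real (card F') \<le> poly list_size_poly (1/\<epsilon>)"
  proof -
    have "f' \<in> cube n \<rightarrow> carrier G'" using fH hc by (auto simp: f'_def)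
    then show "finite F'" "real (card F') \<le> poly list_size_poly (1/\<epsilon>)"
      using list_size_poly_nat[OF assms(1) G'(1) assms(3)] by (auto simp: list_decodable_def F'_def)
  qed
  have "inj_on T F"
  proof (rule inj_onI)
    fix P Q assume PQ: "P \<in> F" "Q \<in> F" "T P = T Q"
    have "P x = Q x" if "x \<in> cube n" for x
      using fun_cong[OF PQ(3), of x] that PH[OF PQ(1) that] PH[OF PQ(2) that] inj_on_eq_iff[OF G'(3)]
      by (simp add: T_def)
    moreover have "P \<in> extensional (cube n)" "Q \<in> extensional (cube n)"
      using PQ by (auto simp: F_def linear_polys_def)
    ultimately show "P = Q" by (rule extensionalityI[rotated 2])
  qed
  moreover have "T ` F \<subseteq> F'" using TP dist by (auto simp: F'_def F_def)
  ultimately have "card F \<le> card F'" using F'(1) by (rule card_inj_on_le)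
  then have "real (card F) \<le> poly list_size_poly (1/\<epsilon>)" using F'(2) by linarith
  then show "finite {P \<in> linear_polys n G. rel_dist (cube n) f P \<le> 1/2 - \<epsilon>} \<and>
      real (card {P \<in> linear_polys n G. rel_dist (cube n) f P \<le> 1/2 - \<epsilon>}) \<le> poly list_size_poly (1/\<epsilon>)"
    using finF by (simp add: F_def)
qed

end
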